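(* Let $n\ge 2$, let $1\le p<\infty$, let $\Omega\subset\mathbb{R}^n$ be a domain and let $f:\Omega\to\mathbb{R}^n$ be a locally finite piecewise affine homeomorphism (onto its image). Then for every $\epsilon>0$ there exists an injective map $\tilde f\in\mathcal{C}^1(\Omega,\mathbb{R}^n)$ such that $$\|\tilde f-f\|_{L^\infty(\Omega)}<\epsilon \quad\text{and}\quad \|D\tilde f-Df\|_{L^p(\Omega)}<\epsilon .$$
   Context: An $n$-simplex is the convex hull of $n+1$ points $A_1,\dots,A_{n+1}\in\mathbb{R}^n$ such that $A_2-A_1,\dots,A_{n+1}-A_1$ are linearly independent. A simplicial complex of $\Omega\subset\mathbb{R}^n$ is a countable (possibly finite) set $\mathcal{T}=\{T_1,T_2,\dots\}$ of $n$-simplices with pairwise disjoint interiors such that $\Omega=\bigcup_i T_i$. It is locally finite if for every $x\in\Omega$ there is $r>0$ such that only finitely many $T_i$ intersect $B(x,r)$. A map $f$ on $\Omega$ is piecewise affine if there is a simplicial complex $\mathcal{T}$ of $\Omega$ such that on each $T_i\in\mathcal{T}$ the map $f$ equals some affine map $L_i(x)=M_ix+c_i$. A locally finite piecewise affine homeomorphism is a homeomorphism which is piecewise affine with respect to a locally finite $\mathcal{T}$. The derivative $Df$ is defined almost everywhere (in the interiors of the simplices). *)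

theory Defs
  imports "HOL-Analysis.Analysis" "HOL-Probability.Essential_Supremum"
begin

text \<open>The simplices are closed and full-dimensional, and are not required to meet face-to-face.\<close>

definition simplicial_complex_of :: "(real^'n) set \<Rightarrow> (real^'n) set set \<Rightarrow> bool" where
  "simplicial_complex_of \<Omega> \<T> \<longleftrightarrow>
     countable \<T> \<and>
     (\<forall>T\<in>\<T>. int CARD('n) simplex T) \<and>
     pairwise (\<lambda>S T. interior S \<inter> interior T = {}) \<T> \<and>
     \<Omega> = \<Union>\<T>"

definition locally_finite_complex :: "(real^'n) set \<Rightarrow> (real^'n) set set \<Rightarrow> bool" where
  "locally_finite_complex \<Omega> \<T> \<longleftrightarrow>
     (\<forall>x\<in>\<Omega>. \<exists>r>0. finite {T\<in>\<T>. T \<inter> ball x r \<noteq> {}})"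

definition affine_on_simplices :: "(real^'n) set set \<Rightarrow> (real^'n \<Rightarrow> real^'n) \<Rightarrow> bool" where
  "affine_on_simplices \<T> f \<longleftrightarrow>
     (\<forall>T\<in>\<T>. \<exists>(M::real^'n^'n) c. \<forall>x\<in>T. f x = M *v x + c)"

definition locally_finite_pw_affine_homeomorphism ::
    "(real^'n) set \<Rightarrow> (real^'n \<Rightarrow> real^'n) \<Rightarrow> bool" where
  "locally_finite_pw_affine_homeomorphism \<Omega> f \<longleftrightarrow>
     (\<exists>g. homeomorphism \<Omega> (f ` \<Omega>) f g) \<and>
     (\<exists>\<T>. simplicial_complex_of \<Omega> \<T> \<and> locally_finite_complex \<Omega> \<T> \<and> affine_on_simplices \<T> f)"

text \<open>Intended for open sets. As usual for $C^1(\Omega)$, no bound on the map or its derivative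
  and no extension to the boundary is required.\<close>

definition C1_on :: "(real^'n) set \<Rightarrow> (real^'n \<Rightarrow> real^'n) \<Rightarrow> bool" where
  "C1_on \<Omega> g \<longleftrightarrow>
     (\<forall>x\<in>\<Omega>. g differentiable (at x)) \<and> continuous_on \<Omega> (\<lambda>x. jacobian g (at x))"

text \<open>Both norms are taken with respect to the (complete) Lebesgue measure on \<open>\<Omega>\<close>, so that they
  do not depend on the values on a null set; in particular a derivative may take
  arbitrary values where it does not exist. They are \<open>\<infinity>\<close> for maps that are not in the
  corresponding space (for \<open>L\<^sup>\<infinity>\<close>, non-measurability is handled by \<^const>\<open>esssup\<close>). Matrices
  are measured by the Euclidean (Frobenius) norm of the type.\<close>

definition Linf_norm :: "'a::euclidean_space set \<Rightarrow> ('a \<Rightarrow> 'b::euclidean_space) \<Rightarrow> ennreal" where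
  "Linf_norm \<Omega> g = esssup (lebesgue_on \<Omega>) (\<lambda>x. ennreal (norm (g x)))"

definition Lp_norm ::
    "real \<Rightarrow> 'a::euclidean_space set \<Rightarrow> ('a \<Rightarrow> 'b::euclidean_space) \<Rightarrow> ennreal" where
  "Lp_norm p \<Omega> g =
     (let I = \<integral>\<^sup>+ x. ennreal (norm (g x) powr p) \<partial>lebesgue_on \<Omega>
      in if g \<in> borel_measurable (lebesgue_on \<Omega>) \<and> I < \<infinity>
         then ennreal (enn2real I powr (1 / p)) else \<infinity>)"

end

theory Submission
  imports Defs
begin

text \<open>
  The map is $g = f\circ\phi$ for a homeomorphism $\phi$ of $\Omega$ that flattens $f$ along the
  facets. Let $F_k$ be the facets of the simplices, with unit normals $a_k$. The inverse
  $\psi = \phi^{-1}$ is a small perturbation $\psi(y) = y + \sum_k w_k(y)\,a_k$ of the identity,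
  where $w_k$ is supported near $F_k$, vanishes on $F_k$ and has infinite slope in direction $a_k$
  there. Up to a small Lipschitz error each summand is monotone, so $\psi$ is strongly monotone;
  with Brouwer's theorem it is a bijection with $2$-Lipschitz inverse. The infinite slopes of
  $\psi$ make $\phi$ of class $C^1$ and force the range of $D\phi(x)$ to be orthogonal to $a_k$
  whenever $\phi(x)\in F_k$. The affine pieces of $f$ around $\phi(x)$ have the same linear part
  on the vectors orthogonal to all these $a_k$, because moving from $\phi(x)$ along such a vector
  stays in every simplex containing $\phi(x)$. Hence $f\circ\phi$ is $C^1$.

  Both norms are controlled by the supports alone: near $F_k$ the map $f$ is $L_k$-Lipschitz, so
  $|Dg - Df| \le C L_k$ there, and it suffices that $w_k$ lives in a neighbourhood of the null set
  $F_k$ whose size and measure are small compared with $L_k$. No limit of derivatives is needed.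

  Derivatives are handled in the strict sense: strict differentiability at every point of an open
  set is the same as $C^1$, and it turns differentiability of $\phi$ and continuity of $D\phi$ into
  a single estimate.
\<close>

text \<open>Smoothing \<open>f\<close> itself endangers injectivity; precomposing with a
  homeomorphism of \<open>\<Omega>\<close> keeps it for free, at the price of a derivative that
  degenerates on the facets, which the statement allows. The perturbation is prescribed for the
  inverse \<open>\<psi>\<close> and not for \<open>\<phi>\<close>, because monotonicity and infinite
  slopes are additive: where several facets meet, in whatever position and with linearly dependent
  normals, the contributions are simply summed, without an induction over the dimension of faces.

  The logarithm in the crease reconciles two demands on its slope \<open>lam\<close>: it must be
  unbounded at the crease, while \<open>|l| |grad lam|\<close> stays bounded, since this product is
  the loss of monotonicity. A negative power of \<open>\<tau>\<close> would violate the second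
  demand.

  The losses of all creases add up to at most 1/2, so half of the monotonicity of the identity
  survives; this is the origin of the Lipschitz constant 2.\<close>

section \<open>Strict differentiability and the calculus of creases\<close>

definition has_strict_derivative ::
    "('a::real_normed_vector \<Rightarrow> 'b::real_normed_vector) \<Rightarrow> ('a \<Rightarrow> 'b) \<Rightarrow> 'a \<Rightarrow> bool" where
  "has_strict_derivative f D x \<longleftrightarrow> bounded_linear D \<and>
     (\<forall>e>0. \<exists>r>0. \<forall>y\<in>ball x r. \<forall>z\<in>ball x r. norm (f y - f z - D (y - z)) \<le> e * norm (y - z))"

lemma has_strict_derivativeD:
  assumes "has_strict_derivative f D x" "e > 0"
  obtains r where "r > 0"
    "\<And>y z. y \<in> ball x r \<Longrightarrow> z \<in> ball x r \<Longrightarrow> norm (f y - f z - D (y - z)) \<le> e * norm (y - z)"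
  using assms unfolding has_strict_derivative_def by meson

lemma has_strict_derivative_imp_has_derivative:
  assumes "has_strict_derivative f D x"
  shows "(f has_derivative D) (at x)"
proof (unfold has_derivative_within_alt2, intro conjI allI impI)
  show "bounded_linear D" using assms by (simp add: has_strict_derivative_def)
  fix e :: real assume "0 < e"
  then obtain r where r: "r > 0"
    "\<And>y z. y \<in> ball x r \<Longrightarrow> z \<in> ball x r \<Longrightarrow> norm (f y - f z - D (y - z)) \<le> e * norm (y - z)"
    using has_strict_derivativeD[OF assms] by metis
  show "\<forall>\<^sub>F y in at x. norm (f y - f x - D (y - x)) \<le> e * norm (y - x)"
    unfolding eventually_at using r by (intro exI[of _ r]) (auto simp: dist_commute)
qed

text \<open>On a small ball, \<open>f\<close> minus the linear map given by \<open>G x\<close> has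
  gradient \<open>G u - G x\<close>, of norm below \<open>e\<close>; the mean value inequality then
  applies between any two points of the ball, not only from its centre.\<close>

lemma has_strict_derivative_gradient:
  fixes f :: "'a::euclidean_space \<Rightarrow> real"
  assumes "open U" "x \<in> U"
    and der: "\<And>y. y \<in> U \<Longrightarrow> (f has_derivative (\<lambda>h. G y \<bullet> h)) (at y)"
    and cont: "continuous_on U G"
  shows "has_strict_derivative f (\<lambda>h. G x \<bullet> h) x"
  unfolding has_strict_derivative_def
proof (intro conjI allI impI)
  show "bounded_linear (\<lambda>h. G x \<bullet> h)" by (rule bounded_linear_inner_right)
  fix e :: real assume e: "0 < e"
  obtain r1 where r1: "r1 > 0" "ball x r1 \<subseteq> U" using assms(1,2) openE by blast
  have "isCont G x" using cont assms(1,2) continuous_on_eq_continuous_at by blast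
  then obtain r2 where r2: "r2 > 0" "\<And>y. dist y x < r2 \<Longrightarrow> dist (G y) (G x) < e"
    using e unfolding continuous_at by (metis continuous_at_eps_delta \<open>isCont G x\<close>)
  define r where "r = min r1 r2"
  show "\<exists>r>0. \<forall>y\<in>ball x r. \<forall>z\<in>ball x r. norm (f y - f z - G x \<bullet> (y - z)) \<le> e * norm (y - z)"
  proof (intro exI[of _ r] conjI ballI)
    show "r > 0" using r1 r2 by (simp add: r_def)
    fix y z assume yz: "y \<in> ball x r" "z \<in> ball x r"
    have "norm ((f y - G x \<bullet> y) - (f z - G x \<bullet> z)) \<le> e * norm (y - z)"
    proof (rule differentiable_bound[of "ball x r" _ "\<lambda>u h. (G u - G x) \<bullet> h"])
      show "convex (ball x r)" by simp
      fix u assume u: "u \<in> ball x r"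
      then have "u \<in> U" using r1 by (auto simp: r_def)
      show "((\<lambda>y. f y - G x \<bullet> y) has_derivative (\<bullet>) (G u - G x)) (at u within ball x r)"
        by (rule has_derivative_at_withinI)
           (use der[OF \<open>u \<in> U\<close>] in \<open>auto intro!: derivative_eq_intros simp: inner_diff_left\<close>)
      have "norm (G u - G x) < e" using r2(2)[of u] u by (simp add: r_def dist_norm norm_minus_commute)
      then show "onorm ((\<bullet>) (G u - G x)) \<le> e" 
        by (intro onorm_bound)
           (auto intro!: order_trans[OF Cauchy_Schwarz_ineq2] mult_right_mono simp: e less_imp_le)
    qed (use yz in auto)
    then show "norm (f y - f z - G x \<bullet> (y - z)) \<le> e * norm (y - z)"
      by (simp add: inner_diff_right algebra_simps)
  qed
qed

text \<open>A crease is a scalar function that is $C^1$ off a closed piece \<open>F\<close> of a hyperplane with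
  unit normal \<open>a\<close> and has slope $+\infty$ in direction \<open>a\<close> along \<open>F\<close>. The second clause is the
  infinite slope; the first one bounds the loss of monotonicity of \<open>x \<mapsto> w x *\<^sub>R a\<close>.\<close>

definition crease :: "('a::euclidean_space \<Rightarrow> real) \<Rightarrow> 'a \<Rightarrow> 'a set \<Rightarrow> real \<Rightarrow> bool" where
  "crease w a F c \<longleftrightarrow>
     (\<forall>x y. - c * norm (x - y) * \<bar>a \<bullet> (x - y)\<bar> \<le> (w x - w y) * (a \<bullet> (x - y))) \<and>
     (\<forall>x\<in>F. \<forall>C. \<exists>r>0. \<forall>y\<in>ball x r. \<forall>z\<in>ball x r.
        C * (a \<bullet> (y - z))\<^sup>2 - c * norm (y - z) * \<bar>a \<bullet> (y - z)\<bar> \<le> (w y - w z) * (a \<bullet> (y - z))) \<and>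
     (\<forall>x. x \<notin> F \<longrightarrow> (\<exists>D. has_strict_derivative w D x))"

lemma crease_mono:
  assumes "crease w a F c" "c \<le> d"
  shows "crease w a F d"
proof -
  have *: "c * norm x * \<bar>a \<bullet> x\<bar> \<le> d * norm x * \<bar>a \<bullet> x\<bar>" for x
    using assms(2) by (intro mult_right_mono) auto
  show ?thesis
    unfolding crease_def
  proof (intro conjI allI ballI impI)
    fix x y
    have "- c * norm (x - y) * \<bar>a \<bullet> (x - y)\<bar> \<le> (w x - w y) * (a \<bullet> (x - y))"
      using assms(1) unfolding crease_def by blast
    with *[of "x - y"] show "- d * norm (x - y) * \<bar>a \<bullet> (x - y)\<bar> \<le> (w x - w y) * (a \<bullet> (x - y))"
      by simp
  next
    fix x C assume "x \<in> F"
    then obtain r where r: "r > 0" "\<And>y z. y \<in> ball x r \<Longrightarrow> z \<in> ball x r \<Longrightarrow>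
        C * (a \<bullet> (y - z))\<^sup>2 - c * norm (y - z) * \<bar>a \<bullet> (y - z)\<bar> \<le> (w y - w z) * (a \<bullet> (y - z))"
      using assms(1) unfolding crease_def by meson
    have "C * (a \<bullet> (y - z))\<^sup>2 - d * norm (y - z) * \<bar>a \<bullet> (y - z)\<bar> \<le> (w y - w z) * (a \<bullet> (y - z))"
      if "y \<in> ball x r" "z \<in> ball x r" for y z
      using r(2)[OF that] *[of "y - z"] by linarith
    then show "\<exists>r>0. \<forall>y\<in>ball x r. \<forall>z\<in>ball x r.
        C * (a \<bullet> (y - z))\<^sup>2 - d * norm (y - z) * \<bar>a \<bullet> (y - z)\<bar> \<le> (w y - w z) * (a \<bullet> (y - z))"
      using r(1) by blast
  qed (use assms(1) in \<open>auto simp: crease_def\<close>)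
qed

lemma crease_scale:
  assumes "crease w a F c" "s > 0"
  shows "crease (\<lambda>x. s * w x) a F (s * c)"
  unfolding crease_def
proof (intro conjI allI impI ballI)
  fix x y
  have "s * (- c * norm (x - y) * \<bar>a \<bullet> (x - y)\<bar>) \<le> s * ((w x - w y) * (a \<bullet> (x - y)))"
    using assms unfolding crease_def by (intro mult_left_mono) auto
  then show "- (s * c) * norm (x - y) * \<bar>a \<bullet> (x - y)\<bar> \<le> (s * w x - s * w y) * (a \<bullet> (x - y))"
    by (simp add: algebra_simps)
next
  fix x C assume "x \<in> F"
  then obtain r where r: "r > 0" "\<forall>y\<in>ball x r. \<forall>z\<in>ball x r.
     (C / s) * (a \<bullet> (y - z))\<^sup>2 - c * norm (y - z) * \<bar>a \<bullet> (y - z)\<bar> \<le> (w y - w z) * (a \<bullet> (y - z))"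
    using assms unfolding crease_def by metis
  show "\<exists>r>0. \<forall>y\<in>ball x r. \<forall>z\<in>ball x r.
     C * (a \<bullet> (y - z))\<^sup>2 - s * c * norm (y - z) * \<bar>a \<bullet> (y - z)\<bar> \<le> (s * w y - s * w z) * (a \<bullet> (y - z))"
  proof (intro exI[of _ r] conjI ballI)
    fix y z assume "y \<in> ball x r" "z \<in> ball x r"
    then have "s * ((C / s) * (a \<bullet> (y - z))\<^sup>2 - c * norm (y - z) * \<bar>a \<bullet> (y - z)\<bar>)
        \<le> s * ((w y - w z) * (a \<bullet> (y - z)))"
      using r assms(2) by (intro mult_left_mono) auto
    then show "C * (a \<bullet> (y - z))\<^sup>2 - s * c * norm (y - z) * \<bar>a \<bullet> (y - z)\<bar>
        \<le> (s * w y - s * w z) * (a \<bullet> (y - z))"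
      using assms(2) by (simp add: algebra_simps)
  qed (use r in auto)
next
  fix x assume "x \<notin> F"
  then obtain D where D: "has_strict_derivative w D x" using assms by (auto simp: crease_def)
  have "has_strict_derivative (\<lambda>x. s * w x) (\<lambda>h. s * D h) x"
    unfolding has_strict_derivative_def
  proof (intro conjI allI impI)
    show "bounded_linear (\<lambda>h. s * D h)"
      using D bounded_linear_const_mult by (auto simp: has_strict_derivative_def)
    fix e :: real assume "0 < e"
    then obtain r where r: "r > 0" "\<And>y z. y \<in> ball x r \<Longrightarrow> z \<in> ball x r \<Longrightarrow>
        norm (w y - w z - D (y - z)) \<le> (e / s) * norm (y - z)"
      using has_strict_derivativeD[OF D, of "e / s"] assms(2) by auto
    have "norm (s * w y - s * w z - s * D (y - z)) \<le> e * norm (y - z)"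
      if "y \<in> ball x r" "z \<in> ball x r" for y z
    proof -
      have "norm (s * w y - s * w z - s * D (y - z)) = s * norm (w y - w z - D (y - z))"
        using assms(2) by (simp add: abs_mult flip: right_diff_distrib)
      also have "\<dots> \<le> s * ((e / s) * norm (y - z))"
        using r(2)[OF that] assms(2) by (intro mult_left_mono) auto
      finally show ?thesis using assms(2) by simp
    qed
    then show "\<exists>r>0. \<forall>y\<in>ball x r. \<forall>z\<in>ball x r.
        norm (s * w y - s * w z - s * D (y - z)) \<le> e * norm (y - z)"
      using r(1) by blast
  qed
  then show "\<exists>D. has_strict_derivative (\<lambda>x. s * w x) D x" by blast
qed

text \<open>The gradient of the product is
  \<open>lam x *\<^sub>R a + (a \<bullet> x - b) *\<^sub>R L x\<close>. The first summand yields the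
  slope \<open>lam x\<close> in direction \<open>a\<close>; the second has norm at most
  \<open>c\<close> and accounts for the whole loss. The mean value theorem is available only off
  \<open>F\<close>, so it serves pairs on one side of the hyperplane, while pairs on different sides
  are compared through their values.\<close>

lemma crease_mult:
  fixes a :: "'a::euclidean_space" and b :: real and lam :: "'a \<Rightarrow> real"
  assumes F: "closed F" "F \<subseteq> {x. a \<bullet> x = b}"
    and nonneg: "\<And>x. 0 \<le> lam x"
    and der: "\<And>x. x \<notin> F \<Longrightarrow> (lam has_derivative (\<lambda>h. L x \<bullet> h)) (at x)"
    and cont: "continuous_on (- F) L"
    and bound: "\<And>x. x \<notin> F \<Longrightarrow> \<bar>a \<bullet> x - b\<bar> * norm (L x) \<le> c"
    and lim: "\<And>x C. x \<in> F \<Longrightarrow> \<exists>r>0. \<forall>y\<in>ball x r - F. C \<le> lam y"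
    and c: "0 \<le> c"
  shows "crease (\<lambda>x. (a \<bullet> x - b) * lam x) a F c"
proof -
  define w where "w = (\<lambda>x. (a \<bullet> x - b) * lam x)"
  define G where "G = (\<lambda>x. lam x *\<^sub>R a + (a \<bullet> x - b) *\<^sub>R L x)"
  have wder: "(w has_derivative (\<lambda>h. G x \<bullet> h)) (at x)" if "x \<notin> F" for x
    unfolding w_def G_def
    by (rule has_derivative_eq_rhs, rule derivative_intros, (rule derivative_intros)+, rule der[OF that])
       (auto simp: fun_eq_iff inner_simps algebra_simps)
  have lamcont: "continuous_on (- F) lam"
    using der by (intro continuous_at_imp_continuous_on) (auto intro: has_derivative_continuous)
  have strict: "\<exists>D. has_strict_derivative w D x" if "x \<notin> F" for x
  proof (rule exI, rule has_strict_derivative_gradient[of "- F" _ _ G])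
    show "continuous_on (- F) G"
      unfolding G_def by (intro continuous_intros cont lamcont)
  qed (use F(1) that wder in auto)
  have same: "C * (a \<bullet> (y - z))\<^sup>2 - c * norm (y - z) * \<bar>a \<bullet> (y - z)\<bar> \<le> (w y - w z) * (a \<bullet> (y - z))"
    if B: "convex B" "\<And>x. x \<in> B - F \<Longrightarrow> C \<le> lam x" "y \<in> B" "z \<in> B"
      and avoid: "\<And>t. t \<in> {0..1} \<Longrightarrow> a \<bullet> (z + t *\<^sub>R (y - z)) \<noteq> b" for B C y z
  proof -
    define p where "p = (\<lambda>t::real. z + t *\<^sub>R (y - z))"
    have pF: "p t \<notin> F" if "t \<in> {0..1}" for t using avoid[OF that] F(2) by (auto simp: p_def)
    have pB: "p t \<in> B" if "t \<in> {0..1}" for t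
      using convexD_alt[OF B(1) B(4) B(3), of t] that by (simp add: p_def algebra_simps)
    have pd: "((\<lambda>t. w (p t)) has_real_derivative (G (p t) \<bullet> (y - z))) (at t)" if "0 \<le> t" "t \<le> 1" for t
    proof -
      have 1: "(p has_derivative (\<lambda>s. s *\<^sub>R (y - z))) (at t)"
        unfolding p_def by (auto intro!: derivative_eq_intros)
      have "((\<lambda>t. w (p t)) has_derivative (\<lambda>s. G (p t) \<bullet> (s *\<^sub>R (y - z)))) (at t)"
        using has_derivative_compose[OF 1 wder[OF pF]] that by simp
      then show ?thesis unfolding has_field_derivative_def
        by (rule has_derivative_eq_rhs) (auto simp: fun_eq_iff)
    qed
    obtain t where t: "0 < t" "t < 1" "w (p 1) - w (p 0) = (1 - 0) * (G (p t) \<bullet> (y - z))"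
      using MVT2[of 0 1 "\<lambda>t. w (p t)" "\<lambda>t. G (p t) \<bullet> (y - z)"] pd by auto
    have w: "w y - w z = G (p t) \<bullet> (y - z)" using t(3) by (simp add: p_def)
    have tt: "t \<in> {0..1}" using t by auto
    define q where "q = ((a \<bullet> p t - b) *\<^sub>R L (p t)) \<bullet> (y - z)"
    have "\<bar>q\<bar> \<le> norm ((a \<bullet> p t - b) *\<^sub>R L (p t)) * norm (y - z)"
      unfolding q_def by (rule Cauchy_Schwarz_ineq2)
    also have "\<dots> \<le> c * norm (y - z)" using bound[OF pF[OF tt]] by (intro mult_right_mono) auto
    finally have q: "\<bar>q\<bar> \<le> c * norm (y - z)" .
    have "\<bar>q * (a \<bullet> (y - z))\<bar> \<le> c * norm (y - z) * \<bar>a \<bullet> (y - z)\<bar>"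
      unfolding abs_mult using q by (intro mult_right_mono) auto
    moreover have "C * (a \<bullet> (y - z))\<^sup>2 \<le> lam (p t) * (a \<bullet> (y - z))\<^sup>2"
      using B(2) pF[OF tt] pB[OF tt] by (intro mult_right_mono) auto
    moreover have "(w y - w z) * (a \<bullet> (y - z)) = lam (p t) * (a \<bullet> (y - z))\<^sup>2 + q * (a \<bullet> (y - z))"
      unfolding w G_def q_def by (simp add: inner_simps algebra_simps power2_eq_square)
    ultimately show ?thesis by linarith
  qed
  \<comment> \<open>\<open>s\<close> and \<open>t\<close> will be the absolute values of
    \<open>a \<bullet> x - b\<close> at two points on different sides, \<open>u\<close> and
    \<open>v\<close> the values of \<open>lam\<close> there. The lower bound \<open>C\<close> is
    known only off \<open>F\<close>, so it is demanded only where the weight is nonzero; points of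
    \<open>F\<close> have weight zero.\<close>
  have sum_ineq: "C * (s + t)\<^sup>2 \<le> (s * u + t * v) * (s + t)"
    if "0 \<le> s" "0 \<le> t" "s \<noteq> 0 \<longrightarrow> C \<le> u" "t \<noteq> 0 \<longrightarrow> C \<le> v" for s t u v C :: real
  proof -
    have "C * s \<le> s * u" "C * t \<le> t * v"
      using that mult_right_mono[of C u s] mult_right_mono[of C v t] by (auto simp: mult.commute)
    then have "C * (s + t) \<le> s * u + t * v" by (simp add: algebra_simps)
    then have "(C * (s + t)) * (s + t) \<le> (s * u + t * v) * (s + t)" using that by (intro mult_right_mono) auto
    then show ?thesis by (simp add: power2_eq_square algebra_simps)
  qed
  have two: "C * (a \<bullet> (y - z))\<^sup>2 - c * norm (y - z) * \<bar>a \<bullet> (y - z)\<bar> \<le> (w y - w z) * (a \<bullet> (y - z))"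
    if B: "convex B" "\<And>x. x \<in> B - F \<Longrightarrow> C \<le> lam x" "y \<in> B" "z \<in> B" for B C y z
  proof -
    have nn: "0 \<le> c * norm (y - z) * \<bar>a \<bullet> (y - z)\<bar>" using c by simp
    have ly: "a \<bullet> y - b \<noteq> 0 \<longrightarrow> C \<le> lam y" and lz: "a \<bullet> z - b \<noteq> 0 \<longrightarrow> C \<le> lam z"
      using B F(2) by auto
    consider "a \<bullet> y - b > 0 \<and> a \<bullet> z - b > 0 \<or> a \<bullet> y - b < 0 \<and> a \<bullet> z - b < 0"
      | "a \<bullet> y - b \<ge> 0 \<and> a \<bullet> z - b \<le> 0" | "a \<bullet> y - b \<le> 0 \<and> a \<bullet> z - b \<ge> 0" by linarith
    then show ?thesis
    proof cases
      case 1
      show ?thesis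
      proof (rule same[OF B])
        fix t :: real assume t: "t \<in> {0..1}"
        have e: "a \<bullet> (z + t *\<^sub>R (y - z)) - b = (1 - t) * (a \<bullet> z - b) + t * (a \<bullet> y - b)"
          by (simp add: inner_simps algebra_simps)
        from 1 show "a \<bullet> (z + t *\<^sub>R (y - z)) \<noteq> b"
        proof
          assume p: "a \<bullet> y - b > 0 \<and> a \<bullet> z - b > 0"
          have "0 < (1 - t) * (a \<bullet> z - b) + t * (a \<bullet> y - b)"
          proof (cases "t = 0")
            case False
            then have "0 < t * (a \<bullet> y - b)" "0 \<le> (1 - t) * (a \<bullet> z - b)" using p t by auto
            then show ?thesis by linarith
          qed (use p in auto)
          then show ?thesis using e by auto
        next
          assume p: "a \<bullet> y - b < 0 \<and> a \<bullet> z - b < 0"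
          have "(1 - t) * (a \<bullet> z - b) + t * (a \<bullet> y - b) < 0"
          proof (cases "t = 0")
            case False
            then have "t * (a \<bullet> y - b) < 0" "(1 - t) * (a \<bullet> z - b) \<le> 0"
              using p t by (auto simp: mult_less_0_iff mult_le_0_iff)
            then show ?thesis by linarith
          qed (use p in auto)
          then show ?thesis using e by auto
        qed
      qed
    next
      case 2
      have e: "a \<bullet> (y - z) = (a \<bullet> y - b) + (b - a \<bullet> z)" by (simp add: inner_diff_right)
      have w: "w y - w z = (a \<bullet> y - b) * lam y + (b - a \<bullet> z) * lam z"
        by (simp add: w_def algebra_simps)
      have "C * ((a \<bullet> y - b) + (b - a \<bullet> z))\<^sup>2
          \<le> ((a \<bullet> y - b) * lam y + (b - a \<bullet> z) * lam z) * ((a \<bullet> y - b) + (b - a \<bullet> z))"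
        using 2 ly lz by (intro sum_ineq) auto
      then show ?thesis unfolding w e using nn[unfolded e] by linarith
    next
      case 3
      have e: "a \<bullet> (y - z) = - ((b - a \<bullet> y) + (a \<bullet> z - b))" by (simp add: inner_diff_right)
      have w: "w y - w z = - ((b - a \<bullet> y) * lam y + (a \<bullet> z - b) * lam z)"
        by (simp add: w_def algebra_simps)
      have "C * ((b - a \<bullet> y) + (a \<bullet> z - b))\<^sup>2
          \<le> ((b - a \<bullet> y) * lam y + (a \<bullet> z - b) * lam z) * ((b - a \<bullet> y) + (a \<bullet> z - b))"
        using 3 ly lz by (intro sum_ineq) auto
      then show ?thesis unfolding w e using nn[unfolded e]
        by (simp only: power2_minus minus_mult_minus abs_minus_cancel)
    qed
  qed
  have "crease w a F c" unfolding crease_def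
  proof (intro conjI allI ballI impI)
    \<comment> \<open>Nonnegativity of \<open>lam\<close> is the lower bound with
      \<open>C = 0\<close>, valid on the whole space.\<close>
    show "- c * norm (x - y) * \<bar>a \<bullet> (x - y)\<bar> \<le> (w x - w y) * (a \<bullet> (x - y))" for x y
      using two[of UNIV 0 x y] nonneg by simp
  next
    fix x C assume "x \<in> F"
    then obtain r where r: "r > 0" "\<forall>y\<in>ball x r - F. C \<le> lam y" using lim by blast
    then show "\<exists>r>0. \<forall>y\<in>ball x r. \<forall>z\<in>ball x r.
        C * (a \<bullet> (y - z))\<^sup>2 - c * norm (y - z) * \<bar>a \<bullet> (y - z)\<bar> \<le> (w y - w z) * (a \<bullet> (y - z))"
      using two[of "ball x r" C] by (intro exI[of _ r]) auto
  qed (use strict in blast)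
  then show ?thesis by (simp add: w_def)
qed

section \<open>Construction of a crease over a compact piece of a hyperplane\<close>

text \<open>Squared positive parts are the only cutoffs used below: they are C^1, and higher
  smoothness is never called for.\<close>

lemma has_real_derivative_max_square:
  "((\<lambda>t::real. (max 0 t)\<^sup>2) has_real_derivative 2 * max 0 t) (at t)"
proof -
  consider "t > 0" | "t < 0" | "t = 0" by linarith
  then show ?thesis
  proof cases
    case 1
    have "((\<lambda>t::real. t\<^sup>2) has_real_derivative 2 * max 0 t) (at t)"
      using 1 by (auto intro!: derivative_eq_intros)
    then show ?thesis
      by (rule DERIV_cong_ev[THEN iffD1, rotated -1])
         (use 1 eventually_nhds_in_open[of "{0<..}" t] in \<open>auto elim!: eventually_mono\<close>)
  next
    case 2
    have "((\<lambda>t::real. 0) has_real_derivative 2 * max 0 t) (at t)"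
      using 2 by (auto intro!: derivative_eq_intros)
    then show ?thesis
      by (rule DERIV_cong_ev[THEN iffD1, rotated -1])
         (use 2 eventually_nhds_in_open[of "{..<0}" t] in \<open>auto elim!: eventually_mono\<close>)
  next
    case 3
    have "(\<lambda>h. ((max 0 (0 + h))\<^sup>2 - (max 0 (0::real))\<^sup>2) / h) \<midarrow>0\<rightarrow> 0"
    proof (rule Lim_null_comparison)
      show "\<forall>\<^sub>F h in at (0::real). norm (((max 0 (0 + h))\<^sup>2 - (max 0 0)\<^sup>2) / h) \<le> \<bar>h\<bar>"
        by (auto simp: max_def power2_eq_square intro!: always_eventually)
      show "((\<lambda>h::real. \<bar>h\<bar>) \<longlongrightarrow> 0) (at 0)" by (intro tendsto_eq_intros) auto
    qed
    then show ?thesis using 3 by (simp add: has_field_derivative_iff DERIV_def)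
  qed
qed

lemma has_derivative_max_square:
  assumes "(g has_derivative (\<lambda>h. G \<bullet> h)) (at x)"
  shows "((\<lambda>x. (max 0 (g x))\<^sup>2) has_derivative (\<lambda>h. ((2 * max 0 (g x)) *\<^sub>R G) \<bullet> h)) (at x)"
  using has_derivative_compose[OF assms
      has_real_derivative_max_square[of "g x", unfolded has_field_derivative_def]]
  by simp

text \<open>Each ball of a finite subcover contributes the squared positive part of
  \<open>r^2 - |x - c|^2\<close>, positive exactly inside the ball. By compactness the sum has a
  positive minimum on \<open>F\<close>, and dividing by it gives the lower bound 1.\<close>

lemma smooth_bump_exists:
  fixes F N :: "'a::euclidean_space set"
  assumes "compact F" "open N" "F \<subseteq> N"
  obtains \<beta> D K B where
    "compact K" "K \<subseteq> N" "\<And>x. x \<notin> K \<Longrightarrow> \<beta> x = (0::real)" "\<And>x. x \<in> F \<Longrightarrow> 1 \<le> \<beta> x"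
    "\<And>x. (\<beta> has_derivative (\<lambda>h. D x \<bullet> h)) (at x)"
    "continuous_on UNIV D" "\<And>x. norm (D x) \<le> B"
proof -
  have "\<forall>c\<in>F. \<exists>r>0. cball c r \<subseteq> N" using assms by (meson open_contains_cball subsetD)
  then obtain r where r: "\<And>c. c \<in> F \<Longrightarrow> r c > 0 \<and> cball c (r c) \<subseteq> N" by metis
  have "F \<subseteq> (\<Union>c\<in>F. ball c (r c))" using r by force
  then obtain C where C: "C \<subseteq> F" "finite C" "F \<subseteq> (\<Union>c\<in>C. ball c (r c))"
    using compactE_image[OF assms(1), of F "\<lambda>c. ball c (r c)"] by auto
  define g where "g = (\<lambda>c x. (r c)\<^sup>2 - (x - c) \<bullet> (x - c))"
  define \<beta> where "\<beta> = (\<lambda>x. \<Sum>c\<in>C. (max 0 (g c x))\<^sup>2)"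
  define D where "D = (\<lambda>x. \<Sum>c\<in>C. (2 * max 0 (g c x)) *\<^sub>R ((-2) *\<^sub>R (x - c)))"
  have gder: "(g c has_derivative (\<lambda>h. ((-2) *\<^sub>R (x - c)) \<bullet> h)) (at x)" for c x
    unfolding g_def by (auto intro!: derivative_eq_intros simp: inner_commute fun_eq_iff)
  have g_neg: "g c x \<le> 0" if "x \<notin> cball c (r c)" "c \<in> F" for c x
  proof -
    have "r c \<le> norm (x - c)" using that by (simp add: dist_norm norm_minus_commute)
    then have "(r c)\<^sup>2 \<le> (norm (x - c))\<^sup>2" using r[OF that(2)] by (intro power_mono) auto
    then show ?thesis by (simp add: g_def power2_norm_eq_inner)
  qed
  have g_pos: "0 < g c x" if "x \<in> ball c (r c)" for c x
  proof -
    have "norm (x - c) < r c" using that by (simp add: dist_norm norm_minus_commute)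
    then have "(norm (x - c))\<^sup>2 < (r c)\<^sup>2" by (intro power_strict_mono) auto
    then show ?thesis by (simp add: g_def power2_norm_eq_inner)
  qed
  have der: "(\<beta> has_derivative (\<lambda>h. D x \<bullet> h)) (at x)" for x
  proof -
    have "(\<beta> has_derivative (\<lambda>h. \<Sum>c\<in>C. ((2 * max 0 (g c x)) *\<^sub>R ((-2) *\<^sub>R (x - c))) \<bullet> h)) (at x)"
      unfolding \<beta>_def by (rule has_derivative_sum) (rule has_derivative_max_square[OF gder])
    then show ?thesis unfolding D_def by (simp only: inner_sum_left)
  qed
  have zero: "\<beta> x = 0" if "x \<notin> (\<Union>c\<in>C. cball c (r c))" for x
    unfolding \<beta>_def
  proof (rule sum.neutral, intro ballI)
    fix c assume "c \<in> C"
    then have "g c x \<le> 0" using g_neg[of x c] that C(1) by auto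
    then show "(max 0 (g c x))\<^sup>2 = 0" by simp
  qed
  have pos: "0 < \<beta> x" if x: "x \<in> F" for x
  proof -
    obtain c where "c \<in> C" "x \<in> ball c (r c)" using C(3) x by blast
    then show ?thesis unfolding \<beta>_def
      using g_pos[of x c] by (intro sum_pos2[OF C(2), of c]) auto
  qed
  have cont: "continuous_on UNIV \<beta>" unfolding \<beta>_def g_def by (intro continuous_intros)
  obtain m where m: "m > 0" "\<And>x. x \<in> F \<Longrightarrow> m \<le> \<beta> x"
  proof (cases "F = {}")
    case False
    then obtain x0 where "x0 \<in> F" "\<forall>x\<in>F. \<beta> x0 \<le> \<beta> x"
      using continuous_attains_inf[OF assms(1) False continuous_on_subset[OF cont subset_UNIV]] by blast
    then show ?thesis using that[of "\<beta> x0"] pos by auto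
  qed (use that[of 1] in auto)
  have bd: "norm (D x) \<le> (\<Sum>c\<in>C. 2 * (r c)\<^sup>2 * (2 * r c))" for x
    unfolding D_def
  proof (rule sum_norm_le)
    fix c assume "c \<in> C"
    then have c: "c \<in> F" using C by auto
    show "norm ((2 * max 0 (g c x)) *\<^sub>R - 2 *\<^sub>R (x - c)) \<le> 2 * (r c)\<^sup>2 * (2 * r c)"
    proof (cases "x \<in> cball c (r c)")
      case True
      have "max 0 (g c x) \<le> (r c)\<^sup>2" by (simp add: g_def)
      moreover have "norm (x - c) \<le> r c" using True by (simp add: dist_norm norm_minus_commute)
      ultimately have "2 * max 0 (g c x) * (2 * norm (x - c)) \<le> 2 * (r c)\<^sup>2 * (2 * r c)"
        by (intro mult_mono) auto
      then show ?thesis by (simp add: abs_mult)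
    next
      case False
      then show ?thesis using g_neg[OF False c] r[OF c] by simp
    qed
  qed
  show ?thesis
  proof (rule that[of "\<Union>c\<in>C. cball c (r c)" "\<lambda>x. 1 / m * \<beta> x" "\<lambda>x. (1 / m) *\<^sub>R D x"
        "(1 / m) * (\<Sum>c\<in>C. 2 * (r c)\<^sup>2 * (2 * r c))"])
    show "compact (\<Union>c\<in>C. cball c (r c))" using C(2) by (intro compact_UN) auto
    show "(\<Union>c\<in>C. cball c (r c)) \<subseteq> N" using C(1) r by blast
    show "((\<lambda>x. 1 / m * \<beta> x) has_derivative (\<bullet>) ((1 / m) *\<^sub>R D x)) (at x)" for x
      by (rule has_derivative_eq_rhs[OF has_derivative_mult_right[OF der, of "1 / m" x]])
         (simp add: fun_eq_iff)
    show "continuous_on UNIV (\<lambda>x. (1 / m) *\<^sub>R D x)"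
      unfolding D_def g_def by (intro continuous_intros)
    show "norm ((1 / m) *\<^sub>R D x) \<le> (1 / m) * (\<Sum>c\<in>C. 2 * (r c)\<^sup>2 * (2 * r c))" for x
      using bd[of x] m(1) by (simp add: divide_right_mono)
  qed (use zero m in auto)
qed

text \<open>The crease is a multiple of $l\,(-\ln \tau)$ with $l = a\cdot x - b$, where $\tau$ vanishes
  like $l^2 + \kappa^2$ on $F' = \{l = 0, \kappa = 0\}$ and is $1$ off \<open>K\<close>. The bound
  $|\nabla\tau| \le C\sqrt{\tau}$ near $F'$ makes $l\,\nabla\ln\tau$ bounded, although $\ln\tau$
  is not. The set $F'$ is enlarged because the infinite slopes must live on a closed set:
  a cutoff function times a function of \<open>l\<close> would destroy the crease property at the edge.\<close>

lemma crease_exists: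
  fixes a :: "'a::euclidean_space"
  assumes "compact F" "norm a = 1" "F \<subseteq> {x. a \<bullet> x = b}" "open N" "F \<subseteq> N" "0 < \<eta>"
  obtains w F' K where "F \<subseteq> F'" "F' \<subseteq> K" "K \<subseteq> N" "compact K" "continuous_on UNIV w"
    "\<And>x. \<bar>w x\<bar> \<le> \<eta>" "\<And>x. x \<notin> K \<Longrightarrow> w x = 0" "crease w a F' \<eta>"
proof -
  obtain \<beta> D K B where K: "compact K" "K \<subseteq> N" and \<beta>0: "\<And>x. x \<notin> K \<Longrightarrow> \<beta> x = (0::real)"
    and \<beta>1: "\<And>x. x \<in> F \<Longrightarrow> 1 \<le> \<beta> x"
    and \<beta>d: "\<And>x. (\<beta> has_derivative (\<lambda>h. D x \<bullet> h)) (at x)"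
    and D: "continuous_on UNIV D" "\<And>x. norm (D x) \<le> B"
    using smooth_bump_exists[OF assms(1,4,5)] by metis
  have B0: "0 \<le> B" using D(2) norm_ge_zero order_trans by blast
  define l where "l = (\<lambda>x. a \<bullet> x - b)"
  \<comment> \<open>Zero exactly where \<open>\<beta>\<close> is at least 1, hence on
    \<open>F\<close>, and equal to 1 off \<open>K\<close>.\<close>
  define \<kappa> where "\<kappa> = (\<lambda>x. max 0 (1 - \<beta> x))"
  define s where "s = (\<lambda>x. (l x)\<^sup>2 + (\<kappa> x)\<^sup>2)"
  \<comment> \<open>For \<open>s\<close> at most 1 this is \<open>s (2 - s)\<close>, which is
    comparable to \<open>s\<close>; it reaches 1 with slope 0, so \<open>\<tau>\<close> is C^1
    across the level \<open>s = 1\<close>.\<close>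
  define \<tau> where "\<tau> = (\<lambda>x. 1 - (max 0 (1 - s x))\<^sup>2)"
  define lam where "lam = (\<lambda>x. - ln (\<tau> x))"
  define S where "S = (\<lambda>x. (2 * l x) *\<^sub>R a + (- 2 * \<kappa> x) *\<^sub>R D x)"
  define L where "L = (\<lambda>x. (- (2 * max 0 (1 - s x)) / \<tau> x) *\<^sub>R S x)"
  define F' where "F' = {x. s x = 0}"
  have \<beta>c: "continuous_on UNIV \<beta>"
    using \<beta>d by (intro continuous_at_imp_continuous_on) (auto intro: has_derivative_continuous)
  have lc: "continuous_on UNIV l" unfolding l_def by (intro continuous_intros)
  have \<kappa>c: "continuous_on UNIV \<kappa>" unfolding \<kappa>_def by (intro continuous_intros \<beta>c)
  have sc: "continuous_on UNIV s" unfolding s_def by (intro continuous_intros \<kappa>c lc)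
  have \<tau>c: "continuous_on UNIV \<tau>" unfolding \<tau>_def by (intro continuous_intros sc)
  have s0: "0 \<le> s x" for x by (simp add: s_def)
  have s_\<tau>: "s x \<le> \<tau> x" if "s x \<le> 1" for x
  proof -
    have "\<tau> x = s x + s x * (1 - s x)" using that by (simp add: \<tau>_def max_def power2_eq_square algebra_simps)
    then show ?thesis using s0[of x] that by simp
  qed
  have \<tau>_big: "\<tau> x = 1" if "1 \<le> s x" for x using that by (simp add: \<tau>_def)
  have \<tau>_le: "\<tau> x \<le> 1" for x by (simp add: \<tau>_def)
  have \<tau>_pos: "0 < \<tau> x" if "x \<notin> F'" for x
    using that s_\<tau>[of x] \<tau>_big[of x] s0[of x] by (cases "s x \<le> 1") (auto simp: F'_def)
  have F'0: "l x = 0 \<and> \<kappa> x = 0" if "x \<in> F'" for x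
    using that by (simp add: F'_def s_def add_nonneg_eq_0_iff)
  have \<tau>F': "\<tau> x = 0" if "x \<in> F'" for x using that by (simp add: F'_def \<tau>_def)
  have sd: "(s has_derivative (\<lambda>h. S x \<bullet> h)) (at x)" for x
  proof -
    have "((\<lambda>x. 1 - \<beta> x) has_derivative (\<lambda>h. (- D x) \<bullet> h)) (at x)"
      by (auto intro!: derivative_eq_intros \<beta>d)
    note * = has_derivative_max_square[OF this]
    have "((\<lambda>x. (l x)\<^sup>2) has_derivative (\<lambda>h. ((2 * l x) *\<^sub>R a) \<bullet> h)) (at x)"
      unfolding l_def by (auto intro!: derivative_eq_intros)
    from has_derivative_add[OF this *] show ?thesis
      unfolding s_def S_def \<kappa>_def by (rule has_derivative_eq_rhs) (simp add: fun_eq_iff inner_simps)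
  qed
  have \<tau>d: "(\<tau> has_derivative (\<lambda>h. ((2 * max 0 (1 - s x)) *\<^sub>R S x) \<bullet> h)) (at x)" for x
  proof -
    have "((\<lambda>x. 1 - s x) has_derivative (\<lambda>h. (- S x) \<bullet> h)) (at x)"
      by (auto intro!: derivative_eq_intros sd)
    from has_derivative_diff[OF has_derivative_const[of 1] has_derivative_max_square[OF this]]
    show ?thesis unfolding \<tau>_def by simp
  qed
  have lamd: "(lam has_derivative (\<lambda>h. L x \<bullet> h)) (at x)" if "x \<notin> F'" for x
  proof -
    note ln = DERIV_ln[OF \<tau>_pos[OF that], unfolded has_field_derivative_def]
    show ?thesis
      unfolding lam_def L_def
      by (rule has_derivative_eq_rhs[OF has_derivative_minus[OF has_derivative_compose[OF \<tau>d ln]]])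
         (simp add: fun_eq_iff divide_inverse)
  qed
  have root_l: "\<bar>l x\<bar> \<le> sqrt (s x)" and root_k: "\<kappa> x \<le> sqrt (s x)" for x
    by (auto simp: s_def intro!: real_le_rsqrt)
  have Sb: "norm (S x) \<le> 2 * (1 + B) * sqrt (s x)" for x
  proof -
    have "norm (S x) \<le> 2 * \<bar>l x\<bar> + 2 * (\<kappa> x * norm (D x))"
      unfolding S_def by (rule norm_triangle_le) (simp add: assms(2) abs_mult \<kappa>_def)
    also have "\<kappa> x * norm (D x) \<le> sqrt (s x) * B"
      using root_k D(2) s0 by (intro mult_mono) auto
    finally show ?thesis using root_l[of x] by (simp add: algebra_simps)
  qed
  have bound: "\<bar>l x\<bar> * norm (L x) \<le> 4 * (1 + B)" if "x \<notin> F'" for x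
  proof (cases "s x \<le> 1")
    case True
    have "\<bar>l x\<bar> * norm (S x) \<le> sqrt (s x) * (2 * (1 + B) * sqrt (s x))"
      using root_l Sb s0 by (intro mult_mono) auto
    also have "\<dots> = 2 * (1 + B) * s x" using s0[of x] by simp
    also have "\<dots> \<le> 2 * (1 + B) * \<tau> x" using s_\<tau>[OF True] B0 by (intro mult_left_mono) auto
    finally have 1: "\<bar>l x\<bar> * norm (S x) / \<tau> x \<le> 2 * (1 + B)"
      using \<tau>_pos[OF that] by (simp add: divide_le_eq)
    have "\<bar>l x\<bar> * norm (L x) = (2 * max 0 (1 - s x)) * (\<bar>l x\<bar> * norm (S x) / \<tau> x)"
      using \<tau>_pos[OF that] by (simp add: L_def abs_mult)
    also have "\<dots> \<le> 2 * (2 * (1 + B))" using 1 s0[of x] \<tau>_pos[OF that] B0 by (intro mult_mono) auto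
    finally show ?thesis by simp
  next
    case False
    then show ?thesis using B0 by (simp add: L_def)
  qed
  \<comment> \<open>On \<open>F'\<close> this rests on the convention \<open>ln 0 = 0\<close>; in
    \<open>w\<close> the value there is multiplied by \<open>l = 0\<close>.\<close>
  have lam_nn: "0 \<le> lam x" for x
  proof (cases "x \<in> F'")
    case False
    then show ?thesis using \<tau>_pos[OF False] \<tau>_le[of x] by (simp add: lam_def)
  qed (simp add: lam_def \<tau>F')
  have Lc: "continuous_on (- F') L"
  proof -
    have "continuous_on (- F') (\<lambda>x. - (2 * max 0 (1 - s x)) / \<tau> x)"
      using \<tau>_pos by (intro continuous_intros continuous_on_subset[OF sc] continuous_on_subset[OF \<tau>c]) force+
    moreover have "continuous_on (- F') S"
      unfolding S_def by (intro continuous_intros continuous_on_subset[OF lc]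
          continuous_on_subset[OF \<kappa>c] continuous_on_subset[OF D(1)]) auto
    ultimately show ?thesis unfolding L_def by (intro continuous_on_scaleR)
  qed
  have lim: "\<exists>r>0. \<forall>y\<in>ball x r - F'. C \<le> lam y" if "x \<in> F'" for x C
  proof -
    have "isCont \<tau> x" using \<tau>c by (simp add: continuous_on_eq_continuous_at)
    then obtain r where r: "r > 0" "\<And>y. dist y x < r \<Longrightarrow> dist (\<tau> y) (\<tau> x) < exp (- C)"
      by (metis continuous_at_eps_delta exp_gt_zero)
    show ?thesis
    proof (intro exI[of _ r] conjI ballI)
      fix y assume y: "y \<in> ball x r - F'"
      then have "0 < \<tau> y" using \<tau>_pos by auto
      moreover have "\<tau> y < exp (- C)" using r(2)[of y] y \<tau>F'[OF that]
        by (auto simp: dist_commute dist_real_def)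
      ultimately have "ln (\<tau> y) < - C" by (metis ln_exp ln_less_cancel_iff exp_gt_zero)
      then show "C \<le> lam y" by (simp add: lam_def)
    qed (use r in auto)
  qed
  have clF': "closed F'"
    unfolding F'_def using continuous_closed_preimage_constant[OF sc closed_UNIV, of 0] by simp
  define w where "w = (\<lambda>x. l x * lam x)"
  have cr: "crease w a F' (4 * (1 + B))"
    unfolding w_def l_def
    by (rule crease_mult[OF clF' _ lam_nn lamd Lc bound[unfolded l_def] lim])
       (use F'0 B0 in \<open>auto simp: l_def\<close>)
  \<comment> \<open>With \<open>q\<close> the fourth root of \<open>s\<close>, \<open>|l|\<close> is
    at most \<open>q^2\<close> and \<open>- ln s = 4 ln (1 / q)\<close> is at most
    \<open>4 / q\<close>. The resulting bound tends to 0 at \<open>F'\<close>, which gives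
    continuity of \<open>w\<close> where the slope is infinite.\<close>
  have wb: "\<bar>w x\<bar> \<le> 4 * sqrt (sqrt (s x))" for x
  proof (cases "x \<in> F' \<or> 1 \<le> s x")
    case True
    then show ?thesis using F'0[of x] \<tau>_big[of x] s0[of x] by (auto simp: w_def lam_def)
  next
    case False
    define q where "q = sqrt (sqrt (s x))"
    have sp: "0 < s x" "s x < 1" using False s0[of x] by (auto simp: F'_def)
    have q: "0 < q" "q * q = sqrt (s x)" using sp by (auto simp: q_def)
    then have "q ^ 4 = s x" using sp by (simp add: power4_eq_xxxx mult.assoc)
    note q = q this
    have "lam x \<le> - ln (s x)" using s_\<tau>[of x] sp by (simp add: lam_def)
    also have "\<dots> = 4 * ln (1 / q)" using q(1) by (simp add: q(3)[symmetric] ln_realpow ln_div)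
    also have "\<dots> \<le> 4 * (1 / q)" using q(1) ln_bound[of "1 / q"] by simp
    finally have "lam x \<le> 4 / q" by simp
    then have "\<bar>l x\<bar> * lam x \<le> (q * q) * (4 / q)"
      using root_l[of x] q lam_nn[of x] s0[of x] by (intro mult_mono) auto
    also have "(q * q) * (4 / q) = 4 * q" using q(1) by simp
    finally show ?thesis using lam_nn[of x] by (simp add: w_def abs_mult q_def)
  qed
  have wc: "continuous_on UNIV w"
  proof (intro continuous_at_imp_continuous_on ballI)
    fix x
    show "isCont w x"
    proof (cases "x \<in> F'")
      case False
      then have "\<exists>D. has_strict_derivative w D x" using cr by (auto simp: crease_def)
      then show ?thesis using has_strict_derivative_imp_has_derivative has_derivative_continuous by blast
    next
      case True
      have "isCont s x" using sc by (simp add: continuous_on_eq_continuous_at)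
      then have "((\<lambda>y. 4 * sqrt (sqrt (s y))) \<longlongrightarrow> 4 * sqrt (sqrt (s x))) (at x)"
        by (intro tendsto_intros) (simp add: isCont_def)
      moreover have "4 * sqrt (sqrt (s x)) = 0" using True by (simp add: F'_def)
      ultimately have "((\<lambda>y. 4 * sqrt (sqrt (s y))) \<longlongrightarrow> 0) (at x)" by metis
      then have "(w \<longlongrightarrow> 0) (at x)"
        by (rule Lim_null_comparison[rotated]) (simp add: wb always_eventually del: mult_le_cancel_left)
      moreover have "w x = 0" using F'0[OF True] by (simp add: w_def)
      ultimately show ?thesis by (simp add: isCont_def)
    qed
  qed
  have w0: "w x = 0" if "x \<notin> K" for x
  proof -
    have "1 \<le> s x" using \<beta>0[OF that] by (simp add: s_def \<kappa>_def)
    then show ?thesis using \<tau>_big[of x] by (simp add: w_def lam_def)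
  qed
  have "bounded (w ` K)"
    using compact_continuous_image[OF continuous_on_subset[OF wc subset_UNIV] K(1)] compact_imp_bounded by blast
  then obtain A where A: "A > 0" "\<And>x. x \<in> K \<Longrightarrow> \<bar>w x\<bar> \<le> A" unfolding bounded_pos by auto
  \<comment> \<open>A single factor \<open>\<eta> / C\<close> brings both the size of
    \<open>w\<close> and its crease constant down to \<open>\<eta>\<close>.\<close>
  define C where "C = max A (4 * (1 + B))"
  have C: "0 < C" "4 * (1 + B) \<le> C" "A \<le> C" using A(1) by (auto simp: C_def)
  have wC: "\<bar>w x\<bar> \<le> C" for x using A(2)[of x] w0[of x] C by (cases "x \<in> K") auto
  show ?thesis
  proof (rule that[of F' K "\<lambda>x. \<eta> / C * w x"])
    show "F \<subseteq> F'"
    proof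
      fix x assume "x \<in> F"
      then show "x \<in> F'" using \<beta>1[of x] assms(3) by (auto simp: F'_def s_def l_def \<kappa>_def)
    qed
    show "F' \<subseteq> K"
    proof
      fix x assume "x \<in> F'"
      then have "\<kappa> x = 0" using F'0 by blast
      then show "x \<in> K" using \<beta>0[of x] by (cases "x \<in> K") (auto simp: \<kappa>_def)
    qed
    show "continuous_on UNIV (\<lambda>x. \<eta> / C * w x)" by (intro continuous_intros wc)
    show "\<bar>\<eta> / C * w x\<bar> \<le> \<eta>" for x
      using C(1) assms(6) mult_left_mono[OF wC[of x], of "\<eta> / C"] by (simp add: abs_mult)
    have "crease (\<lambda>x. \<eta> / C * w x) a F' (\<eta> / C * (4 * (1 + B)))"
      using C(1) assms(6) by (intro crease_scale[OF cr]) auto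
    moreover have "\<eta> / C * (4 * (1 + B)) \<le> \<eta> / C * C"
      using C assms(6) by (intro mult_left_mono) auto
    ultimately show "crease (\<lambda>x. \<eta> / C * w x) a F' \<eta>"
      using C(1) by (auto intro: crease_mono)
  qed (use K w0 in auto)
qed

section \<open>Inverting the identity plus a sum of creases\<close>

text \<open>Strong monotonicity and Cauchy-Schwarz give injectivity and the Lipschitz constant of
  the inverse. For surjectivity, \<open>y \<mapsto> x + (y - \<psi> y)\<close> maps a ball about
  \<open>x\<close> of radius above \<open>B\<close> into itself, and a fixed point solves
  \<open>\<psi> y = x\<close>.\<close>

lemma strongly_monotone_inverse:
  fixes \<psi> :: "'a::euclidean_space \<Rightarrow> 'a"
  assumes cont: "continuous_on UNIV \<psi>"
    and bound: "\<And>y. norm (\<psi> y - y) \<le> B"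
    and mono: "\<And>y z. (norm (y - z))\<^sup>2 / 2 \<le> (\<psi> y - \<psi> z) \<bullet> (y - z)"
  obtains \<phi> where "\<And>x. \<psi> (\<phi> x) = x" "\<And>y. \<phi> (\<psi> y) = y"
    "\<And>x y. norm (\<phi> x - \<phi> y) \<le> 2 * norm (x - y)"
proof -
  have lip: "norm (y - z) \<le> 2 * norm (\<psi> y - \<psi> z)" for y z
  proof (cases "y = z")
    case False
    have "(norm (y - z))\<^sup>2 \<le> 2 * norm (\<psi> y - \<psi> z) * norm (y - z)"
      using mono[of y z] norm_cauchy_schwarz[of "\<psi> y - \<psi> z" "y - z"] by simp
    then show ?thesis using False by (simp add: power2_eq_square)
  qed simp
  have surj: "\<exists>y. \<psi> y = x" for x
  proof -
    have "\<exists>y\<in>cball x (\<bar>B\<bar> + 1). \<psi> y = x"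
    proof (rule brouwer_surjective_cball[of _ _ _ _ "{x}"])
      fix x' y assume "x' \<in> {x}"
      then show "x' + (y - \<psi> y) \<in> cball x (\<bar>B\<bar> + 1)"
        using bound[of y] by (simp add: dist_norm norm_minus_commute)
    qed (auto intro: continuous_on_subset[OF cont])
    then show ?thesis by blast
  qed
  then obtain \<phi> where \<phi>: "\<And>x. \<psi> (\<phi> x) = x" by metis
  have inv: "\<phi> (\<psi> y) = y" for y using lip[of "\<phi> (\<psi> y)" y] \<phi> by simp
  show ?thesis using that[OF \<phi> inv] lip \<phi> by metis
qed

text \<open>The first clause of \<open>crease\<close> is applied at \<open>x + t v\<close> and
  \<open>x\<close>. Its two sides are quadratic in the increment to first order, so dividing by
  \<open>t^2\<close> and letting \<open>t\<close> tend to 0 keeps the inequality.\<close>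

lemma crease_derivative_bound:
  assumes cr: "crease w a F c" and D: "has_strict_derivative w D x"
  shows "- c * norm v * \<bar>a \<bullet> v\<bar> \<le> D v * (a \<bullet> v)"
proof (rule field_le_epsilon)
  fix e :: real assume e: "0 < e"
  define m where "m = norm v * \<bar>a \<bullet> v\<bar> + 1"
  have m: "m > 0" by (simp add: m_def add_nonneg_pos)
  have bl: "bounded_linear D" using D by (simp add: has_strict_derivative_def)
  obtain r where r: "r > 0"
    "\<And>y z. y \<in> ball x r \<Longrightarrow> z \<in> ball x r \<Longrightarrow> norm (w y - w z - D (y - z)) \<le> (e / m) * norm (y - z)"
    using has_strict_derivativeD[OF D, of "e / m"] e m by auto
  define m' where "m' = norm v + 1"
  have m': "m' > 0" by (simp add: m'_def add_nonneg_pos)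
  define t where "t = r / (2 * m')"
  have t: "t > 0" using r m' by (simp add: t_def)
  have "t * norm v < r" 
  proof -
    have "t * m' = r / 2" using m' by (simp add: t_def)
    then show ?thesis using t r by (simp add: m'_def algebra_simps)
  qed
  then have in_ball: "x + t *\<^sub>R v \<in> ball x r" "x \<in> ball x r" using t r by (auto simp: dist_norm)
  have "\<bar>w (x + t *\<^sub>R v) - w x - t * D v\<bar> \<le> (e / m) * (t * norm v)"
    using r(2)[OF in_ball] t by (simp add: linear_simps[OF bl])
  then have "\<bar>(w (x + t *\<^sub>R v) - w x - t * D v) * (a \<bullet> v)\<bar> \<le> ((e / m) * (t * norm v)) * \<bar>a \<bullet> v\<bar>"
    unfolding abs_mult by (intro mult_right_mono) auto
  also have "\<dots> = t * (e * ((norm v * \<bar>a \<bullet> v\<bar>) / m))" by simp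
  also have "\<dots> \<le> t * (e * 1)"
    using t e m by (intro mult_left_mono) (auto simp: m_def)
  finally have 1: "(w (x + t *\<^sub>R v) - w x) * (a \<bullet> v) \<le> t * (D v * (a \<bullet> v)) + t * e"
    by (simp add: algebra_simps)
  have "- c * norm ((x + t *\<^sub>R v) - x) * \<bar>a \<bullet> ((x + t *\<^sub>R v) - x)\<bar>
      \<le> (w (x + t *\<^sub>R v) - w x) * (a \<bullet> ((x + t *\<^sub>R v) - x))"
    using cr unfolding crease_def by blast
  then have "t * (t * (- c * norm v * \<bar>a \<bullet> v\<bar>)) \<le> t * ((w (x + t *\<^sub>R v) - w x) * (a \<bullet> v))"
    using t by (simp add: abs_mult mult_ac)
  then have "t * (- c * norm v * \<bar>a \<bullet> v\<bar>) \<le> (w (x + t *\<^sub>R v) - w x) * (a \<bullet> v)"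
    using t mult_le_cancel_left_pos by blast
  with 1 have "t * (- c * norm v * \<bar>a \<bullet> v\<bar>) \<le> t * (D v * (a \<bullet> v) + e)" by (simp add: algebra_simps)
  then show "- c * norm v * \<bar>a \<bullet> v\<bar> \<le> D v * (a \<bullet> v) + e"
    using t mult_le_cancel_left_pos by blast
qed

text \<open>\<open>P\<close> inverts \<open>A\<close> on the orthogonal complement \<open>V\<close> of the normals, up to a vector
  orthogonal to \<open>V\<close>; it is the limit of the inverses of \<open>A + t Q\<close> as \<open>t \<rightarrow> \<infinity>\<close>, where
  $Q z = \sum_k (a_k\cdot z)\,a_k$.\<close>

lemma constrained_solution_operator:
  fixes A :: "'a::euclidean_space \<Rightarrow> 'a" and a :: "'i \<Rightarrow> 'a"
  assumes "linear A" "finite I" and pos: "\<And>v. v \<noteq> 0 \<Longrightarrow> 0 < v \<bullet> A v"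
  obtains P Z where "linear P" "linear Z" "\<And>u k. k \<in> I \<Longrightarrow> a k \<bullet> P u = 0"
    "\<And>u. A (P u) + (\<Sum>k\<in>I. (a k \<bullet> Z u) *\<^sub>R a k) = u"
proof -
  define Q where "Q = (\<lambda>z. \<Sum>k\<in>I. (a k \<bullet> z) *\<^sub>R a k)"
  define V where "V = {v. \<forall>k\<in>I. a k \<bullet> v = 0}"
  define f where "f = (\<lambda>p. A (fst p) + Q (snd p))"
  have linQ: "linear Q" unfolding Q_def
    by (intro linearI) (simp_all add: inner_add_right scaleR_add_left sum.distrib scaleR_sum_right)
  have V: "subspace V" unfolding V_def by (auto simp: subspace_def inner_add_right)
  have W: "subspace (V \<times> (UNIV :: 'a set))"
    using V by (intro subspace_Times) auto
  have linf: "linear f"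
    by (intro linearI) (simp_all add: f_def linear_add[OF assms(1)] linear_add[OF linQ]
        linear_scale[OF assms(1)] linear_scale[OF linQ] scaleR_add_right)
  \<comment> \<open>A vector \<open>u\<close> orthogonal to the range lies in \<open>V\<close>, as
    the test against \<open>f (0, u)\<close> gives a vanishing sum of squares; the test against
    \<open>f (u, 0)\<close> then contradicts the positivity of \<open>A\<close>.\<close>
  have surj: "f ` (V \<times> UNIV) = UNIV"
  proof (rule ccontr)
    assume "f ` (V \<times> UNIV) \<noteq> UNIV"
    moreover have span: "span (f ` (V \<times> UNIV)) = f ` (V \<times> UNIV)"
      using linear_subspace_image[OF linf W] span_eq_iff by blast
    ultimately obtain u where u: "u \<noteq> 0" "\<And>x. x \<in> f ` (V \<times> UNIV) \<Longrightarrow> u \<bullet> x = 0"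
      using span_not_UNIV_orthogonal[of "f ` (V \<times> UNIV)"] unfolding span by blast
    have "0 \<in> V" using V subspace_0 by blast
    then have "u \<bullet> f (0, u) = 0" by (intro u(2)) auto
    then have "(\<Sum>k\<in>I. (a k \<bullet> u)\<^sup>2) = 0"
      by (simp add: f_def Q_def linear_0[OF assms(1)] inner_sum_right power2_eq_square inner_commute)
    then have "u \<in> V" using assms(2) by (simp add: sum_nonneg_eq_0_iff V_def)
    then have "u \<bullet> f (u, 0) = 0" by (intro u(2)) auto
    then show False using pos[OF u(1)] by (simp add: f_def linear_0[OF linQ])
  qed
  \<comment> \<open>The components of one linear right inverse are the desired \<open>P\<close> and
    \<open>Z\<close>. Linearity of \<open>Z\<close> matters later: it bounds the multipliers
    \<open>a k \<bullet> Z u\<close> by a constant times \<open>norm u\<close>.\<close>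
  obtain g where g: "g ` UNIV \<subseteq> V \<times> UNIV" "linear g" "\<And>u. f (g u) = u"
    using linear_exists_right_inverse_on[OF linf W] surj by auto
  show ?thesis
  proof (rule that[of "\<lambda>u. fst (g u)" "\<lambda>u. snd (g u)"])
    show "linear (\<lambda>u. fst (g u))" "linear (\<lambda>u. snd (g u))"
      using g(2) by (auto intro!: linearI simp: linear_add linear_scale)
    show "a k \<bullet> fst (g u) = 0" if "k \<in> I" for u k
    proof -
      have "g u \<in> V \<times> UNIV" using g(1) by blast
      then show ?thesis using that by (auto simp: V_def)
    qed
    show "A (fst (g u)) + (\<Sum>k\<in>I. (a k \<bullet> snd (g u)) *\<^sub>R a k) = u" for u
      using g(3)[of u] by (simp add: f_def Q_def)
  qed
qed

lemma common_radius:
  assumes "finite J" "\<And>k. k \<in> J \<Longrightarrow> \<exists>r>0. \<forall>y\<in>ball x r. \<forall>z\<in>ball x r. R k y z" "0 < (r0::real)"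
  obtains r where "0 < r" "r \<le> r0" "\<And>k y z. k \<in> J \<Longrightarrow> y \<in> ball x r \<Longrightarrow> z \<in> ball x r \<Longrightarrow> R k y z"
proof -
  obtain f where f: "\<And>k. k \<in> J \<Longrightarrow> f k > 0 \<and> (\<forall>y\<in>ball x (f k). \<forall>z\<in>ball x (f k). R k y z)"
    using assms(2) by metis
  define r where "r = Min (insert r0 (f ` J))"
  have le: "r \<le> r0" "\<And>k. k \<in> J \<Longrightarrow> r \<le> f k" using assms(1) by (auto simp: r_def)
  have "0 < r" using assms f by (auto simp: r_def)
  moreover have "R k y z" if "k \<in> J" "y \<in> ball x r" "z \<in> ball x r" for k y z
    using f[OF that(1)] le(2)[OF that(1)] that(2,3) by force
  ultimately show ?thesis using that le(1) by blast
qed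

text \<open>Put \<open>h = y - z\<close>, \<open>u = \<psi> y - \<psi> z\<close> and
  \<open>E = h - P u\<close>. The creases with \<open>y0\<close> outside \<open>F k\<close> are
  linearised into \<open>A\<close>, which is coercive because the \<open>c k\<close> add up to at
  most 1/2. As \<open>P u\<close> is orthogonal to the other normals, testing the equation for
  \<open>A E\<close> with \<open>E\<close> leaves for each of the other creases a term of the form
  \<open>const |u| t - K t^2\<close> with \<open>t = |a k \<bullet> h|\<close>, hence at most a
  multiple of \<open>|u|^2 / K\<close>. The infinite slope makes \<open>K\<close> as large as
  desired, so \<open>E\<close> is small compared with \<open>u\<close>.\<close>

lemma crease_sum_inverse_has_strict_derivative:
  fixes \<psi> \<phi> :: "'a::euclidean_space \<Rightarrow> 'a" and a :: "'i \<Rightarrow> 'a"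
  assumes J: "finite J" and r: "0 < r"
    and eq: "\<And>y. y \<in> ball y0 r \<Longrightarrow> \<psi> y = y + (\<Sum>k\<in>J. w k y *\<^sub>R a k)"
    and cr: "\<And>k. k \<in> J \<Longrightarrow> crease (w k) (a k) (F k) (c k)"
    and a: "\<And>k. k \<in> J \<Longrightarrow> norm (a k) = 1"
    and c0: "\<And>k. k \<in> J \<Longrightarrow> 0 \<le> c k" and c: "(\<Sum>k\<in>J. c k) \<le> 1 / 2"
    and inv: "\<And>x. \<psi> (\<phi> x) = x" "\<And>y. \<phi> (\<psi> y) = y"
    and lip: "\<And>x y. norm (\<phi> x - \<phi> y) \<le> 2 * norm (x - y)"
  obtains P where "has_strict_derivative \<phi> P (\<psi> y0)"
    "\<And>k u. k \<in> J \<Longrightarrow> y0 \<in> F k \<Longrightarrow> a k \<bullet> P u = 0"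
proof -
  define I where "I = {k\<in>J. y0 \<in> F k}"
  have I: "I \<subseteq> J" "finite I" and JI: "finite (J - I)" using J by (auto simp: I_def)
  have "\<forall>k\<in>J - I. \<exists>D. has_strict_derivative (w k) D y0"
    using cr by (auto simp: I_def crease_def)
  then obtain D where D: "\<And>k. k \<in> J - I \<Longrightarrow> has_strict_derivative (w k) (D k) y0" by metis
  have linD: "linear (D k)" if "k \<in> J - I" for k
    using D[OF that] bounded_linear.linear by (auto simp: has_strict_derivative_def)
  define A where "A = (\<lambda>v. v + (\<Sum>k\<in>J - I. D k v *\<^sub>R a k))"
  have linA: "linear A"
    unfolding A_def
  proof (intro linear_compose_add linear_ident linear_compose_sum ballI)
    fix k assume "k \<in> J - I"
    then show "linear (\<lambda>v. D k v *\<^sub>R a k)"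
      by (intro linearI) (simp_all add: linear_add[OF linD] linear_scale[OF linD] scaleR_add_left)
  qed
  have coercive: "(norm v)\<^sup>2 / 2 \<le> v \<bullet> A v" for v
  proof -
    have "- (norm v)\<^sup>2 / 2 \<le> - (\<Sum>k\<in>J - I. c k) * (norm v)\<^sup>2"
    proof -
      have "(\<Sum>k\<in>J - I. c k) \<le> (\<Sum>k\<in>J. c k)" using J c0 by (intro sum_mono2) auto
      then have "(\<Sum>k\<in>J - I. c k) * (norm v)\<^sup>2 \<le> 1 / 2 * (norm v)\<^sup>2" using c by (intro mult_right_mono) auto
      then show ?thesis by simp
    qed
    also have "\<dots> = (\<Sum>k\<in>J - I. - c k * (norm v)\<^sup>2)" by (simp add: sum_distrib_right sum_negf)
    also have "\<dots> \<le> (\<Sum>k\<in>J - I. D k v * (a k \<bullet> v))"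
    proof (rule sum_mono)
      fix k assume k: "k \<in> J - I"
      have "\<bar>a k \<bullet> v\<bar> \<le> norm v" using Cauchy_Schwarz_ineq2[of "a k" v] a k by simp
      then have "c k * norm v * \<bar>a k \<bullet> v\<bar> \<le> c k * norm v * norm v"
        using c0 k by (intro mult_left_mono) auto
      then show "- c k * (norm v)\<^sup>2 \<le> D k v * (a k \<bullet> v)"
        using crease_derivative_bound[OF cr D[OF k], of v] k by (simp add: power2_eq_square)
    qed
    finally have "- (norm v)\<^sup>2 / 2 \<le> (\<Sum>k\<in>J - I. D k v * (a k \<bullet> v))" .
    then show ?thesis
      by (simp add: A_def inner_add_right inner_sum_right inner_commute power2_norm_eq_inner)
  qed
  have posA: "0 < v \<bullet> A v" if "v \<noteq> 0" for v
    using coercive[of v] that by (smt (verit) zero_less_norm_iff zero_less_power half_gt_zero)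
  obtain P Z where P: "linear P" "\<And>u k. k \<in> I \<Longrightarrow> a k \<bullet> P u = 0" and Z: "linear Z"
    and PZ: "\<And>u. A (P u) + (\<Sum>k\<in>I. (a k \<bullet> Z u) *\<^sub>R a k) = u"
    using constrained_solution_operator[OF linA I(2) posA, of a] by metis
  obtain B where B: "B > 0" "\<And>u. norm (Z u) \<le> B * norm u"
    using linear_bounded_pos[OF Z] by blast
  have "has_strict_derivative \<phi> P (\<psi> y0)"
    unfolding has_strict_derivative_def
  proof (intro conjI allI impI)
    show "bounded_linear P" using P(1) by (simp add: linear_conv_bounded_linear)
    fix e :: real assume e: "0 < e"
    define n where "n = real (card J) + 1"
    have n: "n > 0" by (simp add: n_def)
    \<comment> \<open>Makes the maximum \<open>((B + 1) |u|)^2 / (4 K)\<close> of one such term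
      equal to \<open>e^2 |u|^2 / (4 n)\<close>. Here \<open>B\<close> bounds the multiplier and the
      extra 1 pays for the loss \<open>c k * norm h\<close>, which is at most
      \<open>norm u\<close>.\<close>
    define K where "K = n * (B + 1)\<^sup>2 / e\<^sup>2"
    have K: "K > 0" using n B(1) e by (auto simp: K_def intro!: divide_pos_pos mult_pos_pos)
    obtain r1 where r1: "0 < r1" "r1 \<le> r" and R1: "\<And>k y z. k \<in> J - I \<Longrightarrow> y \<in> ball y0 r1 \<Longrightarrow> z \<in> ball y0 r1 \<Longrightarrow>
        norm (w k y - w k z - D k (y - z)) \<le> (e / (8 * n)) * norm (y - z)"
    proof (rule common_radius[OF JI _ r, of y0
          "\<lambda>k y z. norm (w k y - w k z - D k (y - z)) \<le> (e / (8 * n)) * norm (y - z)"])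
      fix k assume "k \<in> J - I"
      then show "\<exists>r>0. \<forall>y\<in>ball y0 r. \<forall>z\<in>ball y0 r.
          norm (w k y - w k z - D k (y - z)) \<le> (e / (8 * n)) * norm (y - z)"
        using D e n unfolding has_strict_derivative_def by (metis divide_pos_pos mult_pos_pos zero_less_numeral)
    qed blast
    obtain r2 where r2: "0 < r2" "r2 \<le> r1" and R2: "\<And>k y z. k \<in> I \<Longrightarrow> y \<in> ball y0 r2 \<Longrightarrow> z \<in> ball y0 r2 \<Longrightarrow>
        K * (a k \<bullet> (y - z))\<^sup>2 - c k * norm (y - z) * \<bar>a k \<bullet> (y - z)\<bar> \<le> (w k y - w k z) * (a k \<bullet> (y - z))"
    proof (rule common_radius[OF I(2) _ r1(1), of y0
          "\<lambda>k y z. K * (a k \<bullet> (y - z))\<^sup>2 - c k * norm (y - z) * \<bar>a k \<bullet> (y - z)\<bar> \<le> (w k y - w k z) * (a k \<bullet> (y - z))"])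
      fix k assume k: "k \<in> I"
      then have "crease (w k) (a k) (F k) (c k)" "y0 \<in> F k" using cr by (auto simp: I_def)
      then show "\<exists>r>0. \<forall>y\<in>ball y0 r. \<forall>z\<in>ball y0 r.
        K * (a k \<bullet> (y - z))\<^sup>2 - c k * norm (y - z) * \<bar>a k \<bullet> (y - z)\<bar> \<le> (w k y - w k z) * (a k \<bullet> (y - z))"
        unfolding crease_def by blast
    qed blast
    have main: "norm (y - z - P (\<psi> y - \<psi> z)) \<le> e * norm (\<psi> y - \<psi> z)"
      if yz: "y \<in> ball y0 r2" "z \<in> ball y0 r2" for y z
    proof -
      define u where "u = \<psi> y - \<psi> z"
      define h where "h = y - z"
      define E where "E = h - P u"
      define rr where "rr = (\<Sum>k\<in>J - I. (w k y - w k z - D k h) *\<^sub>R a k)"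
      have hu: "norm h \<le> 2 * norm u" using lip[of "\<psi> y" "\<psi> z"] inv by (simp add: h_def u_def)
      have yz1: "y \<in> ball y0 r1" "z \<in> ball y0 r1" using yz r2 by auto
      have "u = h + (\<Sum>k\<in>J. (w k y - w k z) *\<^sub>R a k)"
        using eq[of y] eq[of z] yz r1 r2
        by (simp add: u_def h_def sum_subtractf scaleR_diff_left)
      also have "(\<Sum>k\<in>J. (w k y - w k z) *\<^sub>R a k)
          = (\<Sum>k\<in>J - I. (w k y - w k z) *\<^sub>R a k) + (\<Sum>k\<in>I. (w k y - w k z) *\<^sub>R a k)"
        using sum.subset_diff[OF I(1) J] .
      also have "(\<Sum>k\<in>J - I. (w k y - w k z) *\<^sub>R a k) = (\<Sum>k\<in>J - I. D k h *\<^sub>R a k) + rr"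
        by (simp add: rr_def scaleR_diff_left sum_subtractf)
      finally have "u = A h + rr + (\<Sum>k\<in>I. (w k y - w k z) *\<^sub>R a k)" by (simp add: A_def)
      moreover have "A E = A h - A (P u)" by (simp add: E_def linear_diff[OF linA])
      moreover have "e' = t - r - s" if "u = x + r + s" "e' = x - y" "y + t = u" for e' t r s x y :: 'a
      proof -
        have "y = u - t" using that(3) by (simp add: eq_diff_eq)
        then show ?thesis using that(1,2) by simp
      qed
      ultimately have AE: "A E = (\<Sum>k\<in>I. (a k \<bullet> Z u) *\<^sub>R a k) - rr - (\<Sum>k\<in>I. (w k y - w k z) *\<^sub>R a k)"
        using PZ[of u] by blast
      have aE: "a k \<bullet> E = a k \<bullet> h" if "k \<in> I" for k using P(2)[OF that] by (simp add: E_def inner_diff_right)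
      have nrr: "norm rr \<le> e / 8 * norm h"
      proof -
        have "norm rr \<le> (\<Sum>k\<in>J - I. (e / (8 * n)) * norm h)"
          unfolding rr_def
        proof (rule sum_norm_le)
          fix k assume "k \<in> J - I"
          then show "norm ((w k y - w k z - D k h) *\<^sub>R a k) \<le> (e / (8 * n)) * norm h"
            using R1[of k y z] yz1 a by (simp add: h_def)
        qed
        also have "\<dots> = real (card (J - I)) * ((e / (8 * n)) * norm h)" by simp
        also have "\<dots> \<le> n * ((e / (8 * n)) * norm h)"
          using e n J card_mono[of J "J - I"] by (intro mult_right_mono) (auto simp: n_def)
        finally show ?thesis using n by simp
      qed
      have summand: "(a k \<bullet> Z u) * (a k \<bullet> h) - (w k y - w k z) * (a k \<bullet> h) \<le> e\<^sup>2 * (norm u)\<^sup>2 / (4 * n)"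
        if k: "k \<in> I" for k
      proof -
        define t where "t = \<bar>a k \<bullet> h\<bar>"
        have ak: "norm (a k) = 1" using a k I by auto
        have "c k \<le> (\<Sum>k\<in>J. c k)" using member_le_sum[of k J c] k I(1) J c0 by auto
        then have ck: "0 \<le> c k" "c k \<le> 1 / 2" using c c0 k I by auto
        have "\<bar>a k \<bullet> Z u\<bar> \<le> B * norm u"
          using Cauchy_Schwarz_ineq2[of "a k" "Z u"] ak B(2)[of u] by simp
        then have "\<bar>(a k \<bullet> Z u) * (a k \<bullet> h)\<bar> \<le> B * norm u * t"
          unfolding abs_mult t_def by (intro mult_right_mono) auto
        moreover have "K * (a k \<bullet> h)\<^sup>2 - c k * norm h * t \<le> (w k y - w k z) * (a k \<bullet> h)"
          using R2[OF k yz] by (simp add: h_def t_def)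
        moreover have "c k * norm h * t \<le> norm u * t"
        proof -
          have "c k * norm h \<le> 1 / 2 * (2 * norm u)" using ck hu by (intro mult_mono) auto
          then show ?thesis using mult_right_mono[of "c k * norm h" "norm u" t] by (simp add: t_def)
        qed
        ultimately have "(a k \<bullet> Z u) * (a k \<bullet> h) - (w k y - w k z) * (a k \<bullet> h) \<le> (B + 1) * norm u * t - K * t\<^sup>2"
          by (simp add: t_def algebra_simps)
        also have "\<dots> \<le> ((B + 1) * norm u)\<^sup>2 / (4 * K)"
        proof -
          have "0 \<le> ((B + 1) * norm u - 2 * K * t)\<^sup>2" by simp
          then have "4 * K * ((B + 1) * norm u * t - K * t\<^sup>2) \<le> ((B + 1) * norm u)\<^sup>2"
            by (simp add: power2_eq_square algebra_simps)
          then show ?thesis using K by (simp add: le_divide_eq mult.commute)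
        qed
        also have "\<dots> = e\<^sup>2 * (norm u)\<^sup>2 / (4 * n)"
        proof -
          have "K * e\<^sup>2 = n * (B + 1)\<^sup>2" using e by (simp add: K_def)
          have "((B + 1) * norm u)\<^sup>2 * (4 * n) = (n * (B + 1)\<^sup>2) * (4 * (norm u)\<^sup>2)"
            by (simp only: power_mult_distrib mult_ac)
          also have "\<dots> = (e\<^sup>2 * (norm u)\<^sup>2) * (4 * K)"
            unfolding \<open>K * e\<^sup>2 = n * (B + 1)\<^sup>2\<close>[symmetric] by (simp only: mult_ac)
          finally have "((B + 1) * norm u)\<^sup>2 * (4 * n) = (e\<^sup>2 * (norm u)\<^sup>2) * (4 * K)" .
          then show ?thesis using K n by (simp add: frac_eq_eq)
        qed
        finally show ?thesis .
      qed
      have "(norm E)\<^sup>2 / 2 \<le> E \<bullet> A E" by (rule coercive)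
      moreover have "E \<bullet> A E = (\<Sum>k\<in>I. (a k \<bullet> Z u) * (a k \<bullet> h) - (w k y - w k z) * (a k \<bullet> h)) - E \<bullet> rr"
      proof -
        have "E \<bullet> (\<Sum>k\<in>I. g k *\<^sub>R a k) = (\<Sum>k\<in>I. g k * (a k \<bullet> h))" for g
          unfolding inner_sum_right
        proof (rule sum.cong[OF refl])
          fix k assume "k \<in> I"
          then show "E \<bullet> (g k *\<^sub>R a k) = g k * (a k \<bullet> h)" using aE[of k] inner_commute[of E "a k"] by simp
        qed
        then show ?thesis unfolding AE by (simp only: inner_diff_right sum_subtractf)
      qed
      moreover have "(\<Sum>k\<in>I. (a k \<bullet> Z u) * (a k \<bullet> h) - (w k y - w k z) * (a k \<bullet> h)) \<le> e\<^sup>2 * (norm u)\<^sup>2 / 4"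
      proof -
        have "(\<Sum>k\<in>I. (a k \<bullet> Z u) * (a k \<bullet> h) - (w k y - w k z) * (a k \<bullet> h))
            \<le> (\<Sum>k\<in>I. e\<^sup>2 * (norm u)\<^sup>2 / (4 * n))" by (rule sum_mono[OF summand])
        also have "\<dots> = real (card I) * (e\<^sup>2 * (norm u)\<^sup>2 / (4 * n))" by simp
        also have "\<dots> \<le> n * (e\<^sup>2 * (norm u)\<^sup>2 / (4 * n))"
          using n card_mono[OF J I(1)] by (intro mult_right_mono) (auto simp: n_def)
        finally show ?thesis using n by simp
      qed
      moreover have "- (E \<bullet> rr) \<le> norm E * (e / 4 * norm u)"
      proof -
        have "norm rr \<le> e / 8 * (2 * norm u)" using nrr mult_left_mono[OF hu, of "e / 8"] e by linarith
        then have "norm E * norm rr \<le> norm E * (e / 4 * norm u)" by (intro mult_left_mono) auto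
        then show ?thesis using Cauchy_Schwarz_ineq2[of E rr] by linarith
      qed
      ultimately have fin: "(norm E)\<^sup>2 / 2 \<le> (e * norm u)\<^sup>2 / 4 + norm E * (e * norm u) / 4"
        unfolding power_mult_distrib by (simp only: times_divide_eq_left times_divide_eq_right)
      \<comment> \<open>If \<open>norm E\<close> were larger, each term on the right of
        \<open>fin\<close> would stay within a quarter of \<open>(norm E)\<^sup>2\<close>, the first
        one strictly.\<close>
      have "norm E \<le> e * norm u"
      proof (rule ccontr)
        assume "\<not> norm E \<le> e * norm u"
        then have lt: "e * norm u < norm E" and nn: "0 \<le> e * norm u" using e by auto
        have "(e * norm u)\<^sup>2 < (norm E)\<^sup>2" using lt nn by (intro power_strict_mono) auto
        moreover have "norm E * (e * norm u) \<le> norm E * norm E" using lt by (intro mult_left_mono) auto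
        ultimately show False using fin unfolding power2_eq_square by linarith
      qed
      then show ?thesis by (simp add: E_def h_def u_def)
    qed
    show "\<exists>r>0. \<forall>x\<in>ball (\<psi> y0) r. \<forall>x'\<in>ball (\<psi> y0) r.
        norm (\<phi> x - \<phi> x' - P (x - x')) \<le> e * norm (x - x')"
    proof (intro exI[of _ "r2 / 2"] conjI ballI)
      have in_ball: "\<phi> x \<in> ball y0 r2" if "x \<in> ball (\<psi> y0) (r2 / 2)" for x
        using lip[of "\<psi> y0" x] that inv(2)[of y0] by (simp add: dist_norm)
      fix x x' assume "x \<in> ball (\<psi> y0) (r2 / 2)" "x' \<in> ball (\<psi> y0) (r2 / 2)"
      from main[OF this[THEN in_ball]]
      show "norm (\<phi> x - \<phi> x' - P (x - x')) \<le> e * norm (x - x')" by (simp add: inv)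
    qed (use r2 in auto)
  qed
  then show ?thesis using that P(2) by (auto simp: I_def)
qed

section \<open>Jacobian bounds and the passage from strict derivatives to C^1\<close>

lemma derivative_le_lipschitz:
  assumes "(f has_derivative D) (at x)" "0 < r"
    and lip: "\<And>y. y \<in> ball x r \<Longrightarrow> norm (f y - f x) \<le> L * norm (y - x)"
  shows "norm (D u) \<le> L * norm u"
proof (rule field_le_epsilon)
  fix e :: real assume e: "0 < e"
  define m where "m = norm u + 1"
  have m: "m > 0" by (simp add: m_def add_nonneg_pos)
  have bl: "bounded_linear D" using assms(1) has_derivative_bounded_linear by blast
  obtain d where d: "d > 0" "\<And>y. norm (y - x) < d \<Longrightarrow> norm (f y - f x - D (y - x)) \<le> e / m * norm (y - x)"
    using assms(1) e m unfolding has_derivative_at_alt by (metis divide_pos_pos)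
  define t where "t = min d r / (2 * m)"
  have t: "t > 0" using d(1) assms(2) m by (simp add: t_def)
  have "t * m = min d r / 2" using m by (simp add: t_def)
  then have "t * m < min d r" using d(1) assms(2) by linarith
  then have tu: "t * norm u < min d r" using t by (simp add: m_def algebra_simps)
  have "norm (t *\<^sub>R D u) \<le> L * norm (t *\<^sub>R u) + e / m * norm (t *\<^sub>R u)"
  proof -
    have "norm (f (x + t *\<^sub>R u) - f x) \<le> L * norm (t *\<^sub>R u)"
      using lip[of "x + t *\<^sub>R u"] tu t by (simp add: dist_norm)
    moreover have "norm (f (x + t *\<^sub>R u) - f x - t *\<^sub>R D u) \<le> e / m * norm (t *\<^sub>R u)"
      using d(2)[of "x + t *\<^sub>R u"] tu t by (simp add: linear_simps[OF bl])
    moreover have "norm (t *\<^sub>R D u) \<le> norm (f (x + t *\<^sub>R u) - f x) + norm (f (x + t *\<^sub>R u) - f x - t *\<^sub>R D u)"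
      by (metis norm_minus_commute norm_triangle_sub)
    ultimately show ?thesis by linarith
  qed
  then have "t * norm (D u) \<le> t * (L * norm u + e * (norm u / m))" using t by (simp add: algebra_simps)
  then have "norm (D u) \<le> L * norm u + e * (norm u / m)" using t mult_le_cancel_left_pos by blast
  also have "e * (norm u / m) \<le> e * 1" using e m by (intro mult_left_mono) (auto simp: m_def)
  finally show "norm (D u) \<le> L * norm u + e" by simp
qed

text \<open>Every entry is at most \<open>e\<close>, and the Frobenius norm is at most the sum of
  the absolute values of the entries. This crude dimension factor is the constant \<open>n\<close>
  of the final estimates.\<close>

lemma norm_matrix_le:
  fixes M :: "real^'n^'m"
  assumes "\<And>u. norm (M *v u) \<le> e * norm u"
  shows "norm M \<le> real CARD('m) * (real CARD('n) * e)"
proof -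
  have entry: "\<bar>M $ i $ j\<bar> \<le> e" for i j
  proof -
    have "M $ i $ j = (M *v axis j 1) $ i" by (simp add: matrix_vector_mul_component cart_eq_inner_axis[symmetric])
    also have "\<bar>\<dots>\<bar> \<le> norm (M *v axis j 1)" by (rule component_le_norm_cart)
    also have "\<dots> \<le> e" using assms[of "axis j 1"] by simp
    finally show ?thesis .
  qed
  have row: "norm (M $ i) \<le> real CARD('n) * e" for i
  proof -
    have "norm (M $ i) \<le> (\<Sum>j\<in>UNIV. \<bar>M $ i $ j\<bar>)" by (rule norm_le_l1_cart)
    also have "\<dots> \<le> (\<Sum>j\<in>(UNIV::'n set). e)" by (rule sum_mono) (rule entry)
    finally show ?thesis by simp
  qed
  have "norm M \<le> (\<Sum>i\<in>UNIV. norm (M $ i))"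
    unfolding norm_vec_def by (rule L2_set_le_sum) simp
  also have "\<dots> \<le> (\<Sum>i\<in>(UNIV::'m set). real CARD('n) * e)" by (rule sum_mono) (rule row)
  finally show ?thesis by simp
qed

lemma jacobian_mult_vec:
  fixes f :: "real^'n \<Rightarrow> real^'m"
  assumes "(f has_derivative D) (at x)"
  shows "jacobian f (at x) *v u = D u"
proof -
  have "(f has_derivative (\<lambda>h. jacobian f (at x) *v h)) (at x)"
    using assms jacobian_works differentiable_def by blast
  then have "(\<lambda>h. jacobian f (at x) *v h) = D" using assms has_derivative_unique by blast
  then show ?thesis by metis
qed

lemma norm_jacobian_le:
  fixes f :: "real^'n \<Rightarrow> real^'n"
  assumes "f differentiable (at x)" "0 < r" "\<And>y. y \<in> ball x r \<Longrightarrow> norm (f y - f x) \<le> L * norm (y - x)"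
  shows "norm (jacobian f (at x)) \<le> real CARD('n) * (real CARD('n) * L)"
proof (rule norm_matrix_le)
  obtain D where D: "(f has_derivative D) (at x)" using assms(1) differentiable_def by blast
  show "norm (jacobian f (at x) *v u) \<le> L * norm u" for u
    unfolding jacobian_mult_vec[OF D] by (rule derivative_le_lipschitz[OF D assms(2,3)])
qed

text \<open>Near \<open>x\<close> the map \<open>g - D\<close> has a Lipschitz constant
  \<open>e'\<close>, so its derivative at each nearby point \<open>y\<close>, which is that of
  \<open>g\<close> at \<open>y\<close> minus \<open>D\<close>, has norm at most \<open>e'\<close>.
  Strictness at \<open>x\<close> thus contains continuity of the Jacobian at
  \<open>x\<close>.\<close>

lemma C1_on_has_strict_derivative:
  fixes g :: "real^'n \<Rightarrow> real^'n"
  assumes "\<And>x. x \<in> \<Omega> \<Longrightarrow> \<exists>D. has_strict_derivative g D x"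
  shows "C1_on \<Omega> g"
  unfolding C1_on_def
proof (intro conjI ballI)
  show diff: "g differentiable (at x)" if "x \<in> \<Omega>" for x
    using assms[OF that] has_strict_derivative_imp_has_derivative differentiable_def by blast
  define N where "N = real CARD('n) * real CARD('n)"
  have N: "N > 0" by (simp add: N_def)
  show "continuous_on \<Omega> (\<lambda>x. jacobian g (at x))"
    unfolding continuous_on_iff
  proof (intro ballI allI impI)
    fix x e assume x: "x \<in> \<Omega>" and e: "0 < (e::real)"
    obtain D where D: "has_strict_derivative g D x" using assms[OF x] by blast
    define e' where "e' = e / (2 * N)"
    have e': "e' > 0" using e N by (simp add: e'_def)
    obtain r where r: "r > 0"
      "\<And>y z. y \<in> ball x r \<Longrightarrow> z \<in> ball x r \<Longrightarrow> norm (g y - g z - D (y - z)) \<le> e' * norm (y - z)"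
      using has_strict_derivativeD[OF D e'] by metis
    have bl: "bounded_linear D" using D by (simp add: has_strict_derivative_def)
    have "dist (jacobian g (at y)) (jacobian g (at x)) < e" if y: "y \<in> \<Omega>" "dist y x < r" for y
    proof -
      have yr: "y \<in> ball x r" using y by (simp add: dist_commute)
      then obtain s where s: "s > 0" "ball y s \<subseteq> ball x r" by (meson open_ball open_contains_ball)
      obtain E where E: "(g has_derivative E) (at y)" using diff[OF y(1)] differentiable_def by blast
      have gD: "((\<lambda>z. g z - D z) has_derivative (\<lambda>h. E h - D h)) (at y)"
        by (intro has_derivative_diff E bounded_linear_imp_has_derivative bl)
      have "norm (jacobian g (at y) - jacobian g (at x)) \<le> real CARD('n) * (real CARD('n) * e')"
      proof (rule norm_matrix_le)
        fix u
        have "(jacobian g (at y) - jacobian g (at x)) *v u = E u - D u"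
          unfolding matrix_vector_mult_diff_rdistrib
          using jacobian_mult_vec[OF E] jacobian_mult_vec[OF has_strict_derivative_imp_has_derivative[OF D]] by simp
        also have "norm \<dots> \<le> e' * norm u"
        proof (rule derivative_le_lipschitz[OF gD s(1)])
          fix z assume "z \<in> ball y s"
          then have "z \<in> ball x r" using s by blast
          from r(2)[OF this yr] show "norm (g z - D z - (g y - D y)) \<le> e' * norm (z - y)"
            by (simp add: linear_simps[OF bl] algebra_simps)
        qed
        finally show "norm ((jacobian g (at y) - jacobian g (at x)) *v u) \<le> e' * norm u" .
      qed
      also have "\<dots> = N * e'" by (simp add: N_def)
      also have "\<dots> < e" using e N by (simp add: e'_def)
      finally show ?thesis by (simp add: dist_norm)
    qed
    then show "\<exists>d>0. \<forall>x'\<in>\<Omega>. dist x' x < d \<longrightarrow> dist (jacobian g (at x')) (jacobian g (at x)) < e"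
      using r(1) by blast
  qed
qed

section \<open>Local structure of a piecewise affine map\<close>

lemma polyhedron_unit_normals:
  assumes "polyhedron (S :: 'a::euclidean_space set)"
  obtains H where "finite H" "\<And>a b. (a, b) \<in> H \<Longrightarrow> norm a = 1" "S = {x. \<forall>(a, b)\<in>H. a \<bullet> x \<le> b}"
proof -
  obtain \<H> where \<H>: "finite \<H>" "S = \<Inter>\<H>" "\<forall>h\<in>\<H>. \<exists>a b. a \<noteq> 0 \<and> h = {x. a \<bullet> x \<le> b}"
    using assms unfolding polyhedron_def by blast
  have "\<forall>h\<in>\<H>. \<exists>p. norm (fst p) = 1 \<and> h = {x. fst p \<bullet> x \<le> snd p}"
  proof
    fix h assume "h \<in> \<H>"
    then obtain a b where ab: "a \<noteq> 0" "h = {x. a \<bullet> x \<le> b}" using \<H>(3) by blast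
    show "\<exists>p. norm (fst p) = 1 \<and> h = {x. fst p \<bullet> x \<le> snd p}"
      by (rule exI[of _ "(a /\<^sub>R norm a, b / norm a)"])
         (use ab in \<open>auto simp: divide_inverse mult.commute mult_le_cancel_left_pos\<close>)
  qed
  then obtain p where p: "\<And>h. h \<in> \<H> \<Longrightarrow> norm (fst (p h)) = 1 \<and> h = {x. fst (p h) \<bullet> x \<le> snd (p h)}"
    by metis
  show ?thesis
  proof (rule that[of "p ` \<H>"])
    have "x \<in> h \<longleftrightarrow> fst (p h) \<bullet> x \<le> snd (p h)" if "h \<in> \<H>" for x h using p[OF that] by blast
    then show "S = {x. \<forall>(a, b)\<in>p ` \<H>. a \<bullet> x \<le> b}" unfolding \<H>(2) by (auto simp: case_prod_unfold)
    show "norm a = 1" if "(a, b) \<in> p ` \<H>" for a b using that p by (metis fst_conv imageE)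
  qed (use \<H>(1) in auto)
qed

text \<open>Restriction to the segment from \<open>y\<close> to \<open>z\<close> turns the cover
  into a finite closed cover of \<open>[0, 1]\<close>, and on an interval the Lipschitz estimates of
  the pieces can be chained.\<close>

lemma lipschitz_on_convex_closed_cover:
  fixes f :: "'a::real_normed_vector \<Rightarrow> 'b::metric_space"
  assumes "finite \<S>" "convex B" "B \<subseteq> \<Union>\<S>" "0 \<le> L"
    and "\<And>S. S \<in> \<S> \<Longrightarrow> closed S" "\<And>S. S \<in> \<S> \<Longrightarrow> L-lipschitz_on S f"
  shows "L-lipschitz_on B f"
proof (rule lipschitz_onI)
  fix y z assume yz: "y \<in> B" "z \<in> B"
  define p where "p = (\<lambda>t::real. y + t *\<^sub>R (z - y))"
  have pd: "dist (p s) (p t) = dist s t * dist y z" for s t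
  proof -
    have "p s - p t = (s - t) *\<^sub>R (z - y)" by (simp add: p_def algebra_simps)
    then show ?thesis by (simp add: dist_norm norm_minus_commute dist_real_def)
  qed
  have "(L * dist y z)-lipschitz_on {0..1} (\<lambda>t. f (p t))"
  proof (rule lipschitz_on_closed_Union[where I = \<S> and U = "\<lambda>S. p -` S"])
    fix S assume S: "S \<in> \<S>"
    show "(L * dist y z)-lipschitz_on (p -` S) (\<lambda>t. f (p t))"
    proof (rule lipschitz_onI)
      fix s t assume "s \<in> p -` S" "t \<in> p -` S"
      then have "dist (f (p s)) (f (p t)) \<le> L * dist (p s) (p t)"
        using lipschitz_onD[OF assms(6)[OF S]] by simp
      then show "dist (f (p s)) (f (p t)) \<le> L * dist y z * dist s t" by (simp add: pd mult_ac)
    qed (use assms(4) in simp)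
    show "closed (p -` S)"
      using assms(5)[OF S] unfolding p_def by (intro closed_vimage) (auto intro!: continuous_intros)
  next
    show "{0..1} \<subseteq> (\<Union>S\<in>\<S>. p -` S)"
    proof
      fix t :: real assume t: "t \<in> {0..1}"
      have "p t \<in> B" using convexD_alt[OF assms(2) yz, of t] t by (simp add: p_def algebra_simps)
      then show "t \<in> (\<Union>S\<in>\<S>. p -` S)" using assms(3) by auto
    qed
  qed (use assms(1,4) in auto)
  from lipschitz_onD[OF this, of 0 1] show "dist (f y) (f z) \<le> L * dist y z"
    by (simp add: p_def dist_commute)
qed (use assms(4) in simp)

text \<open>All that the later argument uses of the complex. There is one facet for each simplex and
  each of its bounding inequalities; facets of different simplices may coincide or overlap. The last
  clause says that \<open>f\<close> has a single linear part near \<open>x\<close> along the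
  directions orthogonal to the normals of all facets through \<open>x\<close>.\<close>

lemma pw_affine_structure:
  fixes f :: "real^'n \<Rightarrow> real^'n"
  assumes "open \<Omega>" and hom: "locally_finite_pw_affine_homeomorphism \<Omega> f"
  obtains F :: "nat \<Rightarrow> (real^'n) set" and a b where
    "\<And>k. compact (F k)" "\<And>k. F k \<subseteq> \<Omega>" "\<And>k. F k \<subseteq> {x. a k \<bullet> x = b k}" "\<And>k. norm (a k) = 1"
    "\<And>x. x \<in> \<Omega> \<Longrightarrow> \<exists>r>0. finite {k. F k \<inter> ball x r \<noteq> {}}"
    "\<And>x. x \<in> \<Omega> \<Longrightarrow> \<exists>r>0. \<exists>L. ball x r \<subseteq> \<Omega> \<and> L-lipschitz_on (ball x r) f"
    "\<And>x. x \<in> \<Omega> \<Longrightarrow> \<exists>r>0. \<exists>M. \<forall>y\<in>ball x r. \<forall>z\<in>ball x r.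
       (\<forall>k. x \<in> F k \<longrightarrow> a k \<bullet> (z - y) = 0) \<longrightarrow> f z - f y = M *v (z - y)"
proof -
  obtain \<T> where sc: "simplicial_complex_of \<Omega> \<T>" and lf: "locally_finite_complex \<Omega> \<T>"
    and aff: "affine_on_simplices \<T> f"
    using hom unfolding locally_finite_pw_affine_homeomorphism_def by blast
  have cT: "countable \<T>" and simp: "\<And>T. T \<in> \<T> \<Longrightarrow> int CARD('n) simplex T" and \<Omega>: "\<Omega> = \<Union>\<T>"
    using sc by (auto simp: simplicial_complex_of_def)
  have "\<forall>T\<in>\<T>. \<exists>H. finite H \<and> (\<forall>(a, b)\<in>H. norm a = 1) \<and> T = {x. \<forall>(a, b)\<in>H. a \<bullet> x \<le> b}"
  proof
    fix T assume "T \<in> \<T>"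
    then obtain H where "finite H" "\<And>a b. (a, b) \<in> H \<Longrightarrow> norm a = 1" "T = {x. \<forall>(a, b)\<in>H. a \<bullet> x \<le> b}"
      using polyhedron_unit_normals[OF simplex_imp_polyhedron[OF simp]] by blast
    then show "\<exists>H. finite H \<and> (\<forall>(a, b)\<in>H. norm a = 1) \<and> T = {x. \<forall>(a, b)\<in>H. a \<bullet> x \<le> b}"
      by (intro exI[of _ H]) auto
  qed
  from bchoice[OF this] obtain H where H0: "\<forall>T\<in>\<T>. finite (H T) \<and> (\<forall>(a, b)\<in>H T. norm a = 1) \<and>
      T = {x. \<forall>(a, b)\<in>H T. a \<bullet> x \<le> b}" ..
  have H: "\<And>T. T \<in> \<T> \<Longrightarrow> finite (H T)"
    "\<And>T a b. T \<in> \<T> \<Longrightarrow> (a, b) \<in> H T \<Longrightarrow> norm a = 1"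
    "\<And>T. T \<in> \<T> \<Longrightarrow> T = {x. \<forall>(a, b)\<in>H T. a \<bullet> x \<le> b}"
    using H0 by blast+
  have memT: "x \<in> T \<longleftrightarrow> (\<forall>a b. (a, b) \<in> H T \<longrightarrow> a \<bullet> x \<le> b)" if "T \<in> \<T>" for x T
    using H(3)[OF that] by auto
  obtain Mat C where Mat: "\<And>T x. T \<in> \<T> \<Longrightarrow> x \<in> T \<Longrightarrow> f x = Mat T *v x + C T"
    using aff unfolding affine_on_simplices_def by metis
  have Mdiff: "f z - f y = Mat T *v (z - y)" if "T \<in> \<T>" "y \<in> T" "z \<in> T" for T y z
    using Mat that by (simp add: matrix_vector_mult_diff_distrib)

  define X where "X = Sigma \<T> H"
  define e where "e = to_nat_on X"
  have "countable X" unfolding X_def using cT H(1) by (intro countable_SIGMA) (auto intro: countable_finite)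
  then have inj: "inj_on e X" unfolding e_def by (rule inj_on_to_nat_on)
  define g where "g = inv_into X e"
  have ge: "g (e p) = p" if "p \<in> X" for p using inj that by (simp add: g_def)
  have gX: "g k \<in> X" if "k \<in> e ` X" for k using that ge by auto
  \<comment> \<open>Indices outside the enumeration get an empty facet, and some unit vector as
    normal so that \<open>norm (a k) = 1\<close> holds for every \<open>k\<close>.\<close>
  define a where "a = (\<lambda>k. if k \<in> e ` X then fst (snd (g k)) else axis undefined 1)"
  define b where "b = (\<lambda>k. snd (snd (g k)))"
  define F where "F = (\<lambda>k. if k \<in> e ` X then fst (g k) \<inter> {x. a k \<bullet> x = b k} else {})"
  have gT: "fst (g k) \<in> \<T>" "snd (g k) \<in> H (fst (g k))" if "k \<in> e ` X" for k
    using gX[OF that] by (auto simp: X_def)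

  \<comment> \<open>The radius is so small that every simplex meeting the ball contains
    \<open>x\<close>, and that bounding inequalities strict at \<open>x\<close> remain strict in the
    ball; by local finiteness these are finitely many open conditions.\<close>
  have near: "\<exists>r>0. ball x r \<subseteq> \<Omega> \<and> finite {T\<in>\<T>. T \<inter> ball x r \<noteq> {}} \<and>
      (\<forall>T\<in>\<T>. T \<inter> ball x r \<noteq> {} \<longrightarrow> x \<in> T) \<and>
      (\<forall>T\<in>\<T>. x \<in> T \<longrightarrow> (\<forall>z\<in>ball x r. \<forall>a b. (a, b) \<in> H T \<longrightarrow> a \<bullet> x < b \<longrightarrow> a \<bullet> z < b))"
    if x: "x \<in> \<Omega>" for x
  proof -
    obtain r0 where r0: "r0 > 0" "finite {T\<in>\<T>. T \<inter> ball x r0 \<noteq> {}}" (is "finite ?N")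
      using lf x unfolding locally_finite_complex_def by blast
    have "\<forall>\<^sub>F z in nhds x. z \<in> \<Omega>" using assms(1) x by (simp add: eventually_nhds_in_open)
    moreover have "\<forall>\<^sub>F z in nhds x. z \<in> ball x r0" using r0(1) by (intro eventually_nhds_in_open) auto
    moreover have "\<forall>\<^sub>F z in nhds x. \<forall>T\<in>?N. x \<notin> T \<longrightarrow> z \<notin> T"
    proof (rule eventually_ball_finite[OF r0(2)], intro ballI)
      fix T assume T: "T \<in> ?N"
      then have "open (- T)" using closed_simplex[OF simp] by auto
      then show "\<forall>\<^sub>F z in nhds x. x \<notin> T \<longrightarrow> z \<notin> T"
        using eventually_nhds_in_open[of "- T" x] by (cases "x \<in> T") auto
    qed
    moreover have "\<forall>\<^sub>F z in nhds x. \<forall>T\<in>?N. \<forall>p\<in>H T. fst p \<bullet> x < snd p \<longrightarrow> fst p \<bullet> z < snd p"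
    proof (rule eventually_ball_finite[OF r0(2)], intro ballI, rule eventually_ball_finite)
      fix T assume T: "T \<in> ?N"
      then show "finite (H T)" using H(1) by blast
      show "\<forall>p\<in>H T. \<forall>\<^sub>F z in nhds x. fst p \<bullet> x < snd p \<longrightarrow> fst p \<bullet> z < snd p"
      proof
        fix p assume "p \<in> H T"
        show "\<forall>\<^sub>F z in nhds x. fst p \<bullet> x < snd p \<longrightarrow> fst p \<bullet> z < snd p"
          using eventually_nhds_in_open[OF open_halfspace_lt, of x "fst p" "snd p"]
          by (cases "fst p \<bullet> x < snd p") auto
      qed
    qed
    ultimately have "\<forall>\<^sub>F z in nhds x. z \<in> \<Omega> \<and> z \<in> ball x r0 \<and> (\<forall>T\<in>?N. x \<notin> T \<longrightarrow> z \<notin> T) \<and>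
        (\<forall>T\<in>?N. \<forall>p\<in>H T. fst p \<bullet> x < snd p \<longrightarrow> fst p \<bullet> z < snd p)" (is "eventually ?Q _")
      by eventually_elim blast
    then obtain r where r0': "r > 0" and Q: "\<And>z. dist z x < r \<Longrightarrow> ?Q z"
      unfolding eventually_nhds_metric by blast
    have "?Q z" if "z \<in> ball x r" for z
      by (rule Q) (use that in \<open>simp add: dist_commute\<close>)
    note r = r0' this
    have sub: "ball x r \<subseteq> ball x r0" using r by blast
    show ?thesis
    proof (intro exI[of _ r] conjI ballI allI impI)
      show "finite {T\<in>\<T>. T \<inter> ball x r \<noteq> {}}"
        by (rule finite_subset[OF _ r0(2)]) (use sub in blast)
      fix T assume T: "T \<in> \<T>"
      show "x \<in> T" if ne: "T \<inter> ball x r \<noteq> {}"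
      proof -
        obtain z where z: "z \<in> T" "z \<in> ball x r" using ne by blast
        then have "T \<in> ?N" using T sub by blast
        then show ?thesis using r(2)[OF z(2)] z(1) by blast
      qed
      fix z a b assume *: "x \<in> T" "z \<in> ball x r" "(a, b) \<in> H T" "a \<bullet> x < b"
      have "T \<in> ?N" using T *(1) r0(1) by auto
      then show "a \<bullet> z < b" using r(2)[OF *(2)] *(3,4) by fastforce
    qed (use r in blast)+
  qed
  \<comment> \<open>A bounding inequality strict at \<open>x\<close> holds at \<open>z\<close> by
    \<open>z\<close>'s closeness to \<open>x\<close>. One that is tight at \<open>x\<close> defines
    a facet through \<open>x\<close>; its normal is orthogonal to \<open>z - y\<close>, so the
    inequality is inherited from \<open>y\<close>.\<close>
  have stay: "z \<in> T"
    if "T \<in> \<T>" "x \<in> T" "y \<in> T" and z: "\<And>a b. (a, b) \<in> H T \<Longrightarrow> a \<bullet> x < b \<Longrightarrow> a \<bullet> z < b"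
      and orth: "\<And>k. x \<in> F k \<Longrightarrow> a k \<bullet> (z - y) = 0" for T x y z
    unfolding memT[OF that(1)]
  proof (intro allI impI)
    fix \<alpha> \<beta> assume h: "(\<alpha>, \<beta>) \<in> H T"
    have "\<alpha> \<bullet> x \<le> \<beta>" using that(1,2) h memT by blast
    then consider "\<alpha> \<bullet> x < \<beta>" | "\<alpha> \<bullet> x = \<beta>" by linarith
    then show "\<alpha> \<bullet> z \<le> \<beta>"
    proof cases
      case 1
      then show ?thesis using z[OF h] by simp
    next
      case 2
      define k where "k = e (T, \<alpha>, \<beta>)"
      have p: "(T, \<alpha>, \<beta>) \<in> X" using h that(1) by (simp add: X_def)
      then have "k \<in> e ` X" "g k = (T, \<alpha>, \<beta>)" using ge by (auto simp: k_def)
      then have "x \<in> F k" "a k = \<alpha>" using 2 that(2) by (auto simp: F_def a_def b_def)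
      then have "\<alpha> \<bullet> (z - y) = 0" using orth by blast
      moreover have "\<alpha> \<bullet> y \<le> \<beta>" using that(1,3) h memT by blast
      ultimately show ?thesis by (simp add: inner_diff_right)
    qed
  qed
  show ?thesis
  proof (rule that[of F a b])
    show "compact (F k)" for k
      using compact_simplex[OF simp[OF gT(1)]] closed_hyperplane[of "a k" "b k"]
      by (auto simp: F_def intro: compact_Int_closed)
    show "F k \<subseteq> \<Omega>" for k using gT(1)[of k] by (auto simp: F_def \<Omega>)
    show "F k \<subseteq> {x. a k \<bullet> x = b k}" for k by (auto simp: F_def)
    show "norm (a k) = 1" for k
      using H(2)[OF gT(1), of k "fst (snd (g k))" "snd (snd (g k))"] gT(2)[of k] by (auto simp: a_def)
  next
    fix x assume x: "x \<in> \<Omega>"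
    from near[OF x] obtain r where nr: "r > 0 \<and> ball x r \<subseteq> \<Omega> \<and> finite {T\<in>\<T>. T \<inter> ball x r \<noteq> {}} \<and>
      (\<forall>T\<in>\<T>. T \<inter> ball x r \<noteq> {} \<longrightarrow> x \<in> T) \<and>
      (\<forall>T\<in>\<T>. x \<in> T \<longrightarrow> (\<forall>z\<in>ball x r. \<forall>a b. (a, b) \<in> H T \<longrightarrow> a \<bullet> x < b \<longrightarrow> a \<bullet> z < b))" ..
    have r: "r > 0" "ball x r \<subseteq> \<Omega>" "finite {T\<in>\<T>. T \<inter> ball x r \<noteq> {}}"
      "\<And>T. T \<in> \<T> \<Longrightarrow> T \<inter> ball x r \<noteq> {} \<Longrightarrow> x \<in> T"
      "\<And>T z a b. T \<in> \<T> \<Longrightarrow> x \<in> T \<Longrightarrow> z \<in> ball x r \<Longrightarrow> (a, b) \<in> H T \<Longrightarrow> a \<bullet> x < b \<Longrightarrow> a \<bullet> z < b"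
      using nr by blast+
    define S where "S = {T\<in>\<T>. T \<inter> ball x r \<noteq> {}}"
    have S: "finite S" "\<And>T. T \<in> S \<Longrightarrow> T \<in> \<T> \<and> x \<in> T" using r by (auto simp: S_def)
    have cover: "ball x r \<subseteq> \<Union>S" using r(2) unfolding \<Omega> S_def by blast
    have "{k. F k \<inter> ball x r \<noteq> {}} \<subseteq> e ` Sigma S H"
    proof
      fix k assume "k \<in> {k. F k \<inter> ball x r \<noteq> {}}"
      then have k: "k \<in> e ` X" "fst (g k) \<inter> ball x r \<noteq> {}" by (auto simp: F_def split: if_splits)
      then have "g k \<in> Sigma S H" using gT[OF k(1)] by (cases "g k") (simp add: S_def)
      moreover have "e (g k) = k" using k(1) by (simp add: g_def f_inv_into_f)
      ultimately show "k \<in> e ` Sigma S H" by force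
    qed
    then have "finite {k. F k \<inter> ball x r \<noteq> {}}"
      by (rule finite_subset) (use S H(1) in auto)
    then show "\<exists>r>0. finite {k. F k \<inter> ball x r \<noteq> {}}" using r(1) by blast
    define L where "L = (\<Sum>T\<in>S. onorm (\<lambda>u. Mat T *v u))"
    have L0: "0 \<le> L" unfolding L_def by (intro sum_nonneg onorm_pos_le) (simp add: matrix_vector_mul_bounded_linear)
    have "L-lipschitz_on (ball x r) f"
    proof (rule lipschitz_on_convex_closed_cover[OF S(1) convex_ball cover L0])
      fix T assume T: "T \<in> S"
      show "closed T" using closed_simplex simp S(2)[OF T] by blast
      show "L-lipschitz_on T f"
      proof (rule lipschitz_onI[OF _ L0])
        fix y z assume "y \<in> T" "z \<in> T"
        then have "f y - f z = Mat T *v (y - z)" using Mdiff S(2)[OF T] by blast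
        also have "norm \<dots> \<le> onorm (\<lambda>u. Mat T *v u) * norm (y - z)"
          by (rule onorm) (simp add: matrix_vector_mul_bounded_linear)
        also have "\<dots> \<le> L * norm (y - z)"
          unfolding L_def using S(1) T
          by (intro mult_right_mono member_le_sum onorm_pos_le) (auto simp: matrix_vector_mul_bounded_linear)
        finally show "dist (f y) (f z) \<le> L * dist y z" by (simp add: dist_norm)
      qed
    qed
    then show "\<exists>r>0. \<exists>L. ball x r \<subseteq> \<Omega> \<and> L-lipschitz_on (ball x r) f" using r(1,2) by blast
    obtain T0 where T0: "T0 \<in> \<T>" "x \<in> T0" using x \<Omega> by blast
    show "\<exists>r>0. \<exists>M. \<forall>y\<in>ball x r. \<forall>z\<in>ball x r.
       (\<forall>k. x \<in> F k \<longrightarrow> a k \<bullet> (z - y) = 0) \<longrightarrow> f z - f y = M *v (z - y)"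
    proof (intro exI[of _ r] conjI exI[of _ "Mat T0"] ballI impI)
      fix y z assume yz: "y \<in> ball x r" "z \<in> ball x r" and orth: "\<forall>k. x \<in> F k \<longrightarrow> a k \<bullet> (z - y) = 0"
      obtain T where "T \<in> S" "y \<in> T" using cover yz(1) by blast
      then have T: "T \<in> \<T>" "x \<in> T" "y \<in> T" using S(2) by auto
      have "z \<in> T" using stay[OF T, of z] r(5)[OF T(1,2) yz(2)] orth by blast
      then have "f z - f y = Mat T *v (z - y)" using Mdiff T by blast
      \<comment> \<open>The linear parts of \<open>T\<close> and \<open>T0\<close> agree on
        \<open>z - y\<close>: by \<open>stay\<close> with \<open>x\<close> as starting point, the
        short step \<open>x + t *\<^sub>R (z - y)\<close> remains in both simplices, where both
        formulas compute \<open>f\<close>.\<close>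
      also have "\<dots> = Mat T0 *v (z - y)"
      proof -
        define t where "t = r / (2 * (norm (z - y) + 1))"
        have n1: "norm (z - y) + 1 > 0" by (simp add: add_nonneg_pos)
        have t: "t > 0" using r(1) n1 by (simp add: t_def)
        have "t * (norm (z - y) + 1) = r / 2" using n1 unfolding t_def by (metis divide_divide_eq_left' less_irrefl nonzero_eq_divide_eq times_divide_eq_left)
        then have "t * norm (z - y) < r" using t r(1) by (simp add: algebra_simps)
        then have w: "x + t *\<^sub>R (z - y) \<in> ball x r" using t by (simp add: dist_norm)
        have "f (x + t *\<^sub>R (z - y)) - f x = t *\<^sub>R (Mat T' *v (z - y))" if T': "T' \<in> \<T>" "x \<in> T'" for T'
        proof -
          have "x + t *\<^sub>R (z - y) \<in> T'"
            by (rule stay[OF T' T'(2)]) (use r(5)[OF T' w] orth in auto)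
          then show ?thesis using Mdiff[OF T'] by (simp add: matrix_vector_mult_scaleR)
        qed
        from this[OF T(1,2)] this[OF T0] show ?thesis using t by simp
      qed
      finally show "f z - f y = Mat T0 *v (z - y)" .
    qed (use r in auto)
  qed
qed

section \<open>The flattening homeomorphism and its composition with \<open>f\<close>\<close>

lemma half_power_sums: "(\<lambda>k. (1 / 2 :: real) ^ (k + 2)) sums (1 / 2)"
  using sums_mult[OF power_half_series, of "1 / 2"] by (simp add: field_simps)

lemma finite_powers_above:
  fixes r :: real
  assumes "0 < r"
  shows "finite {k. r < (1 / 2) ^ k}"
proof -
  obtain n where n: "(1 / 2) ^ n < r" using real_arch_pow_inv[OF assms, of "1 / 2"] by auto
  have "k < n" if "r < (1 / 2) ^ k" for k
  proof (rule ccontr)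
    assume "\<not> k < n"
    then have "(1 / 2 :: real) ^ k \<le> (1 / 2) ^ n" by (intro power_decreasing) auto
    then show False using n that by linarith
  qed
  then have "{k. r < (1 / 2) ^ k} \<subseteq> {..<n}" by blast
  then show ?thesis by (rule finite_subset) simp
qed

text \<open>The bound \<open>\<rho> k \<le> (1 / 2) ^ k\<close> carries local finiteness over from
  the facets to the supports of the creases. The final alternative carries both norm estimates:
  either \<open>\<phi>\<close> is the identity near \<open>x\<close>, or one facet controls at once
  the position of \<open>\<phi> x\<close> and the displacement.\<close>

lemma flattening_homeomorphism:
  fixes F :: "nat \<Rightarrow> 'a::euclidean_space set" and a :: "nat \<Rightarrow> 'a"
  assumes F: "\<And>k. compact (F k)" "\<And>k. F k \<subseteq> {x. a k \<bullet> x = b k}" and a: "\<And>k. norm (a k) = 1"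
    and lf: "\<And>x. x \<in> \<Omega> \<Longrightarrow> \<exists>r>0. finite {k. F k \<inter> ball x r \<noteq> {}}"
    and \<rho>: "\<And>k. 0 < \<rho> k" "\<And>k. \<rho> k \<le> (1 / 2) ^ k"
    and in_\<Omega>: "\<And>k y. y \<in> F k \<Longrightarrow> ball y (\<rho> k) \<subseteq> \<Omega>"
  obtains \<phi> where "inj \<phi>" "\<And>x. x \<in> \<Omega> \<Longrightarrow> \<phi> x \<in> \<Omega>"
    "\<And>x y. norm (\<phi> x - \<phi> y) \<le> 2 * norm (x - y)"
    "\<And>x. x \<in> \<Omega> \<Longrightarrow> \<exists>P. has_strict_derivative \<phi> P x \<and> (\<forall>k u. \<phi> x \<in> F k \<longrightarrow> a k \<bullet> P u = 0)"
    "\<And>x. x \<in> \<Omega> \<Longrightarrow> (\<exists>r>0. \<forall>z\<in>ball x r. \<phi> z = z) \<or>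
       (\<exists>k. \<exists>y\<in>F k. \<phi> x \<in> ball y (\<rho> k) \<and> dist (\<phi> x) x < \<rho> k)"
proof -
  define N where "N = (\<lambda>k. \<Union>y\<in>F k. ball y (\<rho> k))"
  \<comment> \<open>The powers sum to 1/2, the total loss of monotonicity that is allowed; the
    factor \<open>\<rho> k\<close> makes the displacement small compared with the thickness of the
    neighbourhood.\<close>
  define \<eta> where "\<eta> = (\<lambda>k. \<rho> k * (1 / 2) ^ (k + 2))"
  have \<eta>0: "0 < \<eta> k" for k using \<rho>(1) by (simp add: \<eta>_def)
  have \<eta>le: "\<eta> k \<le> (1 / 2) ^ (k + 2)" for k
  proof -
    have "\<rho> k \<le> 1" using \<rho>(2)[of k] power_le_one[of "1 / 2 :: real" k] by linarith
    then show ?thesis unfolding \<eta>_def by (intro mult_left_le_one_le) (use \<rho>(1)[of k] in auto)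
  qed
  have sum\<eta>: "summable \<eta>"
    by (rule summable_comparison_test'[OF sums_summable[OF half_power_sums], of 0])
       (use \<eta>le \<eta>0 in \<open>auto simp: less_imp_le\<close>)
  have suminf\<eta>: "suminf \<eta> \<le> 1 / 2"
    using suminf_le[OF \<eta>le sum\<eta> sums_summable[OF half_power_sums]] sums_unique[OF half_power_sums] by simp
  have "\<exists>w F' K. F k \<subseteq> F' \<and> F' \<subseteq> K \<and> K \<subseteq> N k \<and> compact K \<and> continuous_on UNIV w \<and>
      (\<forall>x. \<bar>w x\<bar> \<le> \<eta> k) \<and> (\<forall>x. x \<notin> K \<longrightarrow> w x = 0) \<and> crease w (a k) F' (\<eta> k)" for k
  proof -
    have "open (N k)" "F k \<subseteq> N k" using \<rho>(1) by (auto simp: N_def)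
    from crease_exists[OF F(1) a F(2) this \<eta>0] show ?thesis by metis
  qed
  then obtain w F' K where FF': "\<And>k. F k \<subseteq> F' k" and F'K: "\<And>k. F' k \<subseteq> K k"
    and KN: "\<And>k. K k \<subseteq> N k" and Kc: "\<And>k. compact (K k)"
    and wc: "\<And>k. continuous_on UNIV (w k)" and w\<eta>: "\<And>k x. \<bar>w k x\<bar> \<le> \<eta> k"
    and w0: "\<And>k x. x \<notin> K k \<Longrightarrow> w k x = 0" and cr: "\<And>k. crease (w k) (a k) (F' k) (\<eta> k)"
    by metis
  have K\<Omega>: "K k \<subseteq> \<Omega>" for k using KN[of k] in_\<Omega> unfolding N_def by blast
  define T where "T = (\<lambda>y k. w k y *\<^sub>R a k)"
  define \<psi> where "\<psi> = (\<lambda>y. y + suminf (T y))"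
  have Tb: "norm (T y k) \<le> \<eta> k" for y k using w\<eta>[of k y] a[of k] by (simp add: T_def)
  have Ts: "summable (T y)" for y by (rule summable_comparison_test'[OF sum\<eta> Tb])
  have \<psi>_cont: "continuous_on UNIV \<psi>"
  proof -
    have "uniform_limit UNIV (\<lambda>n y. \<Sum>k<n. T y k) (\<lambda>y. suminf (T y)) sequentially"
      by (rule Weierstrass_m_test[OF _ sum\<eta>]) (rule Tb)
    then have "continuous_on UNIV (\<lambda>y. suminf (T y))"
      by (rule uniform_limit_theorem[rotated])
         (auto simp: T_def intro!: always_eventually continuous_intros wc)
    then show ?thesis unfolding \<psi>_def by (intro continuous_intros)
  qed
  have \<psi>_bound: "norm (\<psi> y - y) \<le> 1 / 2" for y
    using norm_suminf_le[OF Tb[of y] sum\<eta>] suminf\<eta> by (simp add: \<psi>_def)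
  have \<psi>_mono: "(norm (y - z))\<^sup>2 / 2 \<le> (\<psi> y - \<psi> z) \<bullet> (y - z)" for y z
  proof -
    have s: "summable (\<lambda>k. T y k - T z k)" by (intro summable_diff Ts)
    have "- (1 / 2 * (norm (y - z))\<^sup>2) \<le> - (suminf \<eta> * (norm (y - z))\<^sup>2)"
      using mult_right_mono[OF suminf\<eta>, of "(norm (y - z))\<^sup>2"] by simp
    also have "\<dots> = (\<Sum>k. - (\<eta> k * (norm (y - z))\<^sup>2))"
      using suminf_minus[OF summable_mult2[OF sum\<eta>]] suminf_mult2[OF sum\<eta>] by simp
    also have "\<dots> \<le> (\<Sum>k. (T y k - T z k) \<bullet> (y - z))"
    proof (rule suminf_le)
      fix k
      have "\<bar>a k \<bullet> (y - z)\<bar> \<le> norm (y - z)" using Cauchy_Schwarz_ineq2[of "a k" "y - z"] a by simp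
      then have "\<eta> k * norm (y - z) * \<bar>a k \<bullet> (y - z)\<bar> \<le> \<eta> k * norm (y - z) * norm (y - z)"
        using \<eta>0[of k] by (intro mult_left_mono) auto
      moreover have "- \<eta> k * norm (y - z) * \<bar>a k \<bullet> (y - z)\<bar> \<le> (w k y - w k z) * (a k \<bullet> (y - z))"
        using cr[of k] unfolding crease_def by blast
      moreover have "(T y k - T z k) \<bullet> (y - z) = (w k y - w k z) * (a k \<bullet> (y - z))"
        by (simp add: T_def flip: scaleR_diff_left)
      ultimately show "- (\<eta> k * (norm (y - z))\<^sup>2) \<le> (T y k - T z k) \<bullet> (y - z)"
        by (simp add: power2_eq_square mult.assoc)
      show "summable (\<lambda>k. - (\<eta> k * (norm (y - z))\<^sup>2))"
        by (intro summable_minus summable_mult2 sum\<eta>)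
      show "summable (\<lambda>k. (T y k - T z k) \<bullet> (y - z))"
        by (rule bounded_linear.summable[OF bounded_linear_inner_left s])
    qed
    also have "\<dots> = (\<Sum>k. T y k - T z k) \<bullet> (y - z)"
      using bounded_linear.suminf[OF bounded_linear_inner_left s] by simp
    also have "(\<Sum>k. T y k - T z k) = suminf (T y) - suminf (T z)"
      using suminf_diff[OF Ts Ts] by simp
    finally have "- (1 / 2 * (norm (y - z))\<^sup>2) \<le> (suminf (T y) - suminf (T z)) \<bullet> (y - z)" .
    moreover have "\<psi> y - \<psi> z = (y - z) + (suminf (T y) - suminf (T z))" by (simp add: \<psi>_def)
    ultimately show ?thesis by (simp only: inner_add_left power2_norm_eq_inner)
  qed
  obtain \<phi> where \<phi>: "\<And>x. \<psi> (\<phi> x) = x" "\<And>y. \<phi> (\<psi> y) = y"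
    and lip: "\<And>x y. norm (\<phi> x - \<phi> y) \<le> 2 * norm (x - y)"
    using strongly_monotone_inverse[OF \<psi>_cont \<psi>_bound \<psi>_mono] by metis
  \<comment> \<open>A support meeting the smaller ball comes from a facet meeting
    \<open>ball y r\<close>, or else has \<open>\<rho> k > r / 2\<close>, which is possible for
    finitely many \<open>k\<close> only.\<close>
  have Klf: "\<exists>r>0. finite {k. K k \<inter> ball y r \<noteq> {}}" if y: "y \<in> \<Omega>" for y
  proof -
    obtain r where r: "r > 0" "finite {k. F k \<inter> ball y r \<noteq> {}}" using lf[OF y] by blast
    have "{k. K k \<inter> ball y (r / 2) \<noteq> {}} \<subseteq> {k. F k \<inter> ball y r \<noteq> {}} \<union> {k. r / 2 < (1 / 2) ^ k}"
    proof
      fix k assume "k \<in> {k. K k \<inter> ball y (r / 2) \<noteq> {}}"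
      then obtain z where z: "z \<in> K k" "dist y z < r / 2" by auto
      then obtain y1 where y1: "y1 \<in> F k" "dist y1 z < \<rho> k" using KN[of k] by (auto simp: N_def)
      show "k \<in> {k. F k \<inter> ball y r \<noteq> {}} \<union> {k. r / 2 < (1 / 2) ^ k}"
      proof (cases "\<rho> k \<le> r / 2")
        case True
        then have "dist y y1 < r" using z(2) y1(2) dist_triangle2[of y y1 z] by linarith
        then show ?thesis using y1(1) by auto
      next
        case False
        then show ?thesis using \<rho>(2)[of k] by auto
      qed
    qed
    then have "finite {k. K k \<inter> ball y (r / 2) \<noteq> {}}"
      by (rule finite_subset) (use r finite_powers_above[of "r / 2"] in simp)
    then show ?thesis using r(1) by (intro exI[of _ "r / 2"]) auto
  qed
  \<comment> \<open>\<open>\<psi>\<close> is the identity off \<open>\<Omega>\<close>, so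
    \<open>\<phi> x\<close> outside \<open>\<Omega>\<close> would force
    \<open>x = \<psi> (\<phi> x) = \<phi> x\<close>.\<close>
  have \<phi>\<Omega>: "\<phi> x \<in> \<Omega>" if "x \<in> \<Omega>" for x
  proof (rule ccontr)
    assume "\<phi> x \<notin> \<Omega>"
    then have "T (\<phi> x) = (\<lambda>k. 0)" using K\<Omega> w0[of "\<phi> x"] by (auto simp: T_def fun_eq_iff)
    then have "\<psi> (\<phi> x) = \<phi> x" by (simp add: \<psi>_def)
    then show False using \<phi>(1)[of x] that \<open>\<phi> x \<notin> \<Omega>\<close> by simp
  qed
  show ?thesis
  proof (rule that[of \<phi>])
    show "inj \<phi>" using \<phi>(1) by (metis injI)
    show "\<phi> x \<in> \<Omega>" if "x \<in> \<Omega>" for x by (rule \<phi>\<Omega>[OF that])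
    show "norm (\<phi> x - \<phi> y) \<le> 2 * norm (x - y)" for x y by (rule lip)
  next
    fix x assume x: "x \<in> \<Omega>"
    obtain r where r: "r > 0" "finite {k. K k \<inter> ball (\<phi> x) r \<noteq> {}}" using Klf[OF \<phi>\<Omega>[OF x]] by blast
    define J where "J = {k. K k \<inter> ball (\<phi> x) r \<noteq> {}}"
    have J: "finite J" using r by (simp add: J_def)
    have out: "T z k = 0" if "z \<in> ball (\<phi> x) r" "k \<notin> J" for z k
    proof -
      have "z \<notin> K k" using that by (auto simp: J_def)
      then show ?thesis using w0 by (simp add: T_def)
    qed
    have loc: "\<psi> z = z + (\<Sum>k\<in>J. w k z *\<^sub>R a k)" if "z \<in> ball (\<phi> x) r" for z
      using suminf_finite[OF J, of "T z"] out[OF that] by (simp add: \<psi>_def T_def)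
    have "(\<Sum>k\<in>J. \<eta> k) \<le> 1 / 2"
      using sum_le_suminf[OF sum\<eta> J] \<eta>0 suminf\<eta> by (force simp: less_imp_le)
    then obtain P where P: "has_strict_derivative \<phi> P (\<psi> (\<phi> x))"
      "\<And>k u. k \<in> J \<Longrightarrow> \<phi> x \<in> F' k \<Longrightarrow> a k \<bullet> P u = 0"
      using crease_sum_inverse_has_strict_derivative[OF J r(1) loc cr a less_imp_le[OF \<eta>0] _ \<phi> lip] by metis
    have "a k \<bullet> P u = 0" if "\<phi> x \<in> F k" for k u
    proof (rule P(2))
      show "\<phi> x \<in> F' k" using that FF' by blast
      then have "\<phi> x \<in> K k \<inter> ball (\<phi> x) r" using F'K r(1) by auto
      then show "k \<in> J" unfolding J_def by blast
    qed
    then show "\<exists>P. has_strict_derivative \<phi> P x \<and> (\<forall>k u. \<phi> x \<in> F k \<longrightarrow> a k \<bullet> P u = 0)"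
      using P(1) \<phi>(1) by metis
    define A where "A = {k. \<phi> x \<in> K k}"
    have "A \<subseteq> J" using r(1) by (auto simp: A_def J_def)
    then have A: "finite A" using J finite_subset by blast
    show "(\<exists>r>0. \<forall>z\<in>ball x r. \<phi> z = z) \<or>
        (\<exists>k. \<exists>y\<in>F k. \<phi> x \<in> ball y (\<rho> k) \<and> dist (\<phi> x) x < \<rho> k)"
    proof (cases "A = {}")
      case True
      \<comment> \<open>A neighbourhood of \<open>\<phi> x\<close> free of all supports, hence fixed
        pointwise; in particular \<open>\<phi> x = x\<close>.\<close>
      define U where "U = ball (\<phi> x) r \<inter> (\<Inter>k\<in>J. - K k)"
      have fixed: "\<phi> z = z" if z: "z \<in> U" for z
      proof -
        have "T z k = 0" for k
          using z out[of z k] w0[of z k] by (cases "k \<in> J") (auto simp: U_def T_def)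
        then have "T z = (\<lambda>k. 0)" by blast
        then have "\<psi> z = z" by (simp add: \<psi>_def)
        then show ?thesis using \<phi>(2)[of z] by simp
      qed
      have U: "open U" "\<phi> x \<in> U"
        unfolding U_def using J r(1) True compact_imp_closed[OF Kc]
        by (auto simp: A_def intro!: open_Int open_INT)
      have "\<phi> (\<phi> x) = \<phi> x" by (rule fixed[OF U(2)])
      then have "\<phi> x = x" using \<phi>(1) by metis
      then obtain s where "s > 0" "ball x s \<subseteq> U" using U openE by metis
      then show ?thesis using fixed by blast
    next
      case False
      \<comment> \<open>Several supports may contain \<open>\<phi> x\<close>. For the one with the
        largest \<open>\<rho> k\<close>, all contributions together are at most
        \<open>\<rho> k / 2\<close>.\<close>
      have "Max (\<rho> ` A) \<in> \<rho> ` A" using A False by (intro Max_in) auto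
      then obtain k where k: "k \<in> A" "\<rho> k = Max (\<rho> ` A)" by auto
      have max: "\<rho> j \<le> \<rho> k" if "j \<in> A" for j using A that by (simp add: k(2))
      have "norm (T (\<phi> x) j) \<le> \<rho> k * (1 / 2) ^ (j + 2)" for j
      proof (cases "j \<in> A")
        case True
        have "\<eta> j \<le> \<rho> k * (1 / 2) ^ (j + 2)"
          unfolding \<eta>_def by (intro mult_right_mono max[OF True]) auto
        then show ?thesis using Tb[of "\<phi> x" j] by linarith
      next
        case False
        then show ?thesis using w0[of "\<phi> x" j] \<rho>(1)[of k] by (simp add: A_def T_def)
      qed
      then have "norm (suminf (T (\<phi> x))) \<le> (\<Sum>j. \<rho> k * (1 / 2) ^ (j + 2))"
        by (rule norm_suminf_le) (intro summable_mult sums_summable[OF half_power_sums])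
      also have "\<dots> = \<rho> k * (1 / 2)"
        using sums_unique[OF sums_mult[OF half_power_sums, of "\<rho> k"]] by simp
      also have "\<dots> < \<rho> k" using \<rho>(1)[of k] by simp
      finally have "norm (suminf (T (\<phi> x))) < \<rho> k" .
      moreover have "x - \<phi> x = suminf (T (\<phi> x))"
        using \<phi>(1)[of x] by (simp add: \<psi>_def) (metis add_diff_cancel_left')
      ultimately have "dist (\<phi> x) x < \<rho> k" by (simp add: dist_norm norm_minus_commute)
      moreover have "\<phi> x \<in> N k" using k(1) KN by (auto simp: A_def)
      ultimately show ?thesis by (auto simp: N_def)
    qed
  qed
qed

text \<open>\<open>f\<close> need not be differentiable at \<open>\<phi> x\<close>. With
  \<open>v = P (y - z)\<close>, the step from \<open>\<phi> z\<close> to \<open>\<phi> z + v\<close>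
  is orthogonal to all relevant normals, so \<open>f\<close> changes by exactly
  \<open>M *v v\<close>; the rest, from \<open>\<phi> z + v\<close> to \<open>\<phi> y\<close>, has
  length at most \<open>e' * norm (y - z)\<close> and is absorbed by the Lipschitz bound.\<close>

lemma compose_has_strict_derivative_of_flattening:
  fixes f :: "real^'n \<Rightarrow> real^'m" and \<phi> :: "'a::real_normed_vector \<Rightarrow> real^'n"
  assumes P: "has_strict_derivative \<phi> P x" "\<And>u k. \<phi> x \<in> F k \<Longrightarrow> a k \<bullet> P u = 0"
    and lip: "\<And>z z'. norm (\<phi> z - \<phi> z') \<le> 2 * norm (z - z')"
    and r: "0 < r" and L: "L-lipschitz_on (ball (\<phi> x) r) f"
    and M: "\<And>y z. y \<in> ball (\<phi> x) r \<Longrightarrow> z \<in> ball (\<phi> x) r \<Longrightarrow>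
       (\<And>k. \<phi> x \<in> F k \<Longrightarrow> a k \<bullet> (z - y) = 0) \<Longrightarrow> f z - f y = M *v (z - y)"
  shows "has_strict_derivative (f \<circ> \<phi>) (\<lambda>u. M *v P u) x"
  unfolding has_strict_derivative_def
proof (intro conjI allI impI)
  have "bounded_linear P" using P(1) by (simp add: has_strict_derivative_def)
  then show "bounded_linear (\<lambda>u. M *v P u)"
    using bounded_linear_compose[OF matrix_vector_mul_bounded_linear] by blast
  fix e :: real assume e: "0 < e"
  have L0: "0 \<le> L" using lipschitz_on_nonneg[OF L] .
  define e' where "e' = e / (L + 1)"
  have e': "e' > 0" "L * e' \<le> e" using e L0 by (auto simp: e'_def field_simps)
  obtain s where s: "s > 0"
    "\<And>y z. y \<in> ball x s \<Longrightarrow> z \<in> ball x s \<Longrightarrow> norm (\<phi> y - \<phi> z - P (y - z)) \<le> e' * norm (y - z)"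
    using has_strict_derivativeD[OF P(1) e'(1)] by metis
  \<comment> \<open>Keeps \<open>\<phi> y\<close>, \<open>\<phi> z\<close> and
    \<open>\<phi> z + v\<close> in \<open>ball (\<phi> x) r\<close>: the images are within
    \<open>2 q\<close> of \<open>\<phi> x\<close>, and \<open>v\<close> is no longer than
    \<open>(2 + e') 2 q\<close>.\<close>
  define q where "q = min s (r / (8 + 4 * e'))"
  have q: "q > 0" "q \<le> s" using s(1) r e'(1) by (auto simp: q_def)
  have "q \<le> r / (8 + 4 * e')" by (simp add: q_def)
  then have "q * (8 + 4 * e') \<le> r" using e'(1) by (simp add: le_divide_eq)
  moreover have "q * (8 + 4 * e') = 8 * q + 4 * (q * e')" by (simp add: algebra_simps)
  moreover have "2 * q + (2 + e') * (2 * q) = 6 * q + 2 * (q * e')" by (simp add: algebra_simps)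
  ultimately have qr: "2 * q + (2 + e') * (2 * q) < r"
    using q(1) mult_pos_pos[OF q(1) e'(1)] by linarith
  show "\<exists>q>0. \<forall>y\<in>ball x q. \<forall>z\<in>ball x q. norm ((f \<circ> \<phi>) y - (f \<circ> \<phi>) z - M *v P (y - z)) \<le> e * norm (y - z)"
  proof (intro exI[of _ q] conjI ballI)
    fix y z assume yz: "y \<in> ball x q" "z \<in> ball x q"
    define v where "v = P (y - z)"
    have str: "norm (\<phi> y - \<phi> z - v) \<le> e' * norm (y - z)" unfolding v_def using s(2) yz q(2) by auto
    have yz2: "norm (y - z) \<le> 2 * q"
      using yz dist_triangle3[of y z x] by (simp add: dist_norm)
    have "norm v \<le> norm (\<phi> y - \<phi> z) + norm (\<phi> y - \<phi> z - v)"
      by (metis norm_minus_commute norm_triangle_sub)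
    also have "\<dots> \<le> (2 + e') * norm (y - z)" using str lip[of y z] by (simp add: algebra_simps)
    also have "\<dots> \<le> (2 + e') * (2 * q)" using yz2 e'(1) by (intro mult_left_mono) auto
    finally have nv: "norm v \<le> (2 + e') * (2 * q)" .
    have near: "dist (\<phi> x) (\<phi> y) < 2 * q" if "y \<in> ball x q" for y
      using lip[of x y] that by (simp add: dist_norm)
    have q2: "0 < (2 + e') * (2 * q)" using q(1) e'(1) by (intro mult_pos_pos) auto
    have in1: "\<phi> y \<in> ball (\<phi> x) r" "\<phi> z \<in> ball (\<phi> x) r" using near[OF yz(1)] near[OF yz(2)] qr q2
      unfolding mem_ball by linarith+
    have in2: "\<phi> z + v \<in> ball (\<phi> x) r"
    proof -
      have "dist (\<phi> x) (\<phi> z + v) \<le> dist (\<phi> x) (\<phi> z) + norm v"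
        using dist_triangle[of "\<phi> x" "\<phi> z + v" "\<phi> z"] by (simp add: dist_norm)
      then show ?thesis using near[OF yz(2)] nv qr by simp
    qed
    have "f (\<phi> z + v) - f (\<phi> z) = M *v v"
      using M[OF in1(2) in2] P(2) by (simp add: v_def)
    then have "norm ((f \<circ> \<phi>) y - (f \<circ> \<phi>) z - M *v P (y - z)) = dist (f (\<phi> y)) (f (\<phi> z + v))"
      by (simp add: dist_norm v_def algebra_simps)
    also have "\<dots> \<le> L * dist (\<phi> y) (\<phi> z + v)" by (rule lipschitz_onD[OF L in1(1) in2])
    also have "\<dots> \<le> L * (e' * norm (y - z))"
      using str L0 by (intro mult_left_mono) (auto simp: dist_norm algebra_simps)
    also have "\<dots> \<le> e * norm (y - z)"
      using mult_right_mono[OF e'(2), of "norm (y - z)"] by (simp add: mult.assoc)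
    finally show "norm ((f \<circ> \<phi>) y - (f \<circ> \<phi>) z - M *v P (y - z)) \<le> e * norm (y - z)" .
  qed (use q in auto)
qed

section \<open>Thin neighbourhoods of facets and the norm estimates\<close>

text \<open>\<open>d\<close> is a Lebesgue number of a finite subcover, and the sum of the finitely
  many local constants serves as common constant.\<close>

lemma uniform_lipschitz_thickening:
  fixes f :: "'a::euclidean_space \<Rightarrow> 'b::metric_space"
  assumes "compact F" "F \<subseteq> \<Omega>"
    and loc: "\<And>x. x \<in> \<Omega> \<Longrightarrow> \<exists>r>0. \<exists>L. ball x r \<subseteq> \<Omega> \<and> L-lipschitz_on (ball x r) f"
  obtains d L where "0 < d" "\<And>y. y \<in> F \<Longrightarrow> ball y d \<subseteq> \<Omega>"
    "\<And>y. y \<in> F \<Longrightarrow> L-lipschitz_on (ball y d) f" "0 \<le> L"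
proof -
  have "\<forall>x\<in>F. \<exists>r L. r > 0 \<and> ball x r \<subseteq> \<Omega> \<and> L-lipschitz_on (ball x r) f"
    using assms(2) loc by (meson subsetD)
  then obtain r L where r: "\<And>x. x \<in> F \<Longrightarrow> r x > 0 \<and> ball x (r x) \<subseteq> \<Omega> \<and> (L x)-lipschitz_on (ball x (r x)) f"
    by metis
  have "F \<subseteq> (\<Union>x\<in>F. ball x (r x))" using r by force
  then obtain C where C: "C \<subseteq> F" "finite C" "F \<subseteq> (\<Union>x\<in>C. ball x (r x))"
    using compactE_image[OF assms(1), of F "\<lambda>x. ball x (r x)"] by auto
  obtain d where d: "d > 0" "\<And>x. x \<in> F \<Longrightarrow> \<exists>G\<in>(\<lambda>x. ball x (r x)) ` C. ball x d \<subseteq> G"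
    using Heine_Borel_lemma[OF assms(1) C(3)] by auto
  define M where "M = (\<Sum>x\<in>C. L x)"
  have L0: "0 \<le> L x" if "x \<in> C" for x using r[of x] that C(1) lipschitz_on_nonneg by blast
  have LM: "L x \<le> M" if "x \<in> C" for x
    unfolding M_def using L0 C(2) that by (intro member_le_sum) auto
  have *: "ball y d \<subseteq> \<Omega> \<and> M-lipschitz_on (ball y d) f" if y: "y \<in> F" for y
  proof -
    obtain x where x: "x \<in> C" "ball y d \<subseteq> ball x (r x)" using d(2)[OF y] by auto
    have rx: "ball x (r x) \<subseteq> \<Omega>" "(L x)-lipschitz_on (ball x (r x)) f" using r x C(1) by blast+
    have "(L x)-lipschitz_on (ball y d) f" using rx(2) x(2) by (rule lipschitz_on_subset)
    then show ?thesis using rx(1) x LM lipschitz_on_le by blast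
  qed
  show ?thesis
    by (rule that[OF d(1), of M]) (use * L0 in \<open>auto simp: M_def sum_nonneg\<close>)
qed

text \<open>Outer regularity gives an open set of small measure around \<open>F\<close>; compactness
  fits a uniform neighbourhood into it.\<close>

lemma negligible_compact_thickening:
  fixes F :: "'a::euclidean_space set"
  assumes "compact F" "negligible F" "0 < \<delta>"
  obtains d where "0 < d" "emeasure lebesgue (\<Union>y\<in>F. ball y d) \<le> ennreal \<delta>"
proof -
  have F0: "F \<in> null_sets lebesgue" using assms(2) by (simp add: negligible_iff_null_sets)
  then obtain T where T: "open T" "F \<subseteq> T" "T - F \<in> lmeasurable" "emeasure lebesgue (T - F) < ennreal \<delta>"
    using sets_lebesgue_outer_open[of F \<delta>] assms(3) by auto
  obtain d where d: "d > 0" "\<And>x. x \<in> F \<Longrightarrow> \<exists>G\<in>{T}. ball x d \<subseteq> G"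
    using Heine_Borel_lemma[OF assms(1), of "{T}"] T(1,2) by auto
  have "emeasure lebesgue (\<Union>y\<in>F. ball y d) \<le> emeasure lebesgue T"
    using d(2) T(1) by (intro emeasure_mono) auto
  also have "\<dots> = emeasure lebesgue (T - F)"
    using emeasure_Diff_null_set[OF F0, of T] T(1) by simp
  finally show ?thesis using that[OF d(1)] T(4) by (meson le_less_trans less_imp_le)
qed

lemma AE_lebesgue_on_notin:
  assumes "open \<Omega>" "negligible Z" "\<And>x. x \<in> \<Omega> \<Longrightarrow> x \<notin> Z \<Longrightarrow> P x"
  shows "AE x in lebesgue_on \<Omega>. P x"
proof -
  have "AE x in lebesgue. x \<in> \<Omega> \<longrightarrow> P x"
    by (rule AE_I'[of Z]) (use assms in \<open>auto simp: negligible_iff_null_sets\<close>)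
  then show ?thesis using assms(1) by (subst AE_restrict_space_iff) auto
qed

text \<open>Meant for the Jacobian of \<open>f\<close>, whose values on the facets are arbitrary;
  completeness of Lebesgue measure allows any change on \<open>Z\<close>.\<close>

lemma borel_measurable_lebesgue_on_continuous_off_negligible:
  fixes D :: "'a::euclidean_space \<Rightarrow> 'b::euclidean_space"
  assumes "open \<Omega>" "negligible Z" "continuous_on (\<Omega> - Z) D"
  shows "D \<in> borel_measurable (lebesgue_on \<Omega>)"
proof -
  have Z: "Z \<in> sets lebesgue" "Z \<in> null_sets lebesgue"
    using assms(2) by (auto simp: negligible_iff_null_sets)
  have m: "\<Omega> - Z \<in> sets lebesgue" using assms(1) Z(1) by auto
  have "D \<in> borel_measurable (lebesgue_on (\<Omega> - Z))"
    using assms(3) m by (rule continuous_imp_measurable_on_sets_lebesgue)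
  then have "(\<lambda>x. if x \<in> \<Omega> - Z then D x else 0) \<in> borel_measurable lebesgue"
    by (rule borel_measurable_if_I[OF _ m])
  moreover have "AE x in lebesgue. (if x \<in> \<Omega> - Z then D x else 0) = (if x \<in> \<Omega> then D x else 0)"
    by (rule AE_I'[OF Z(2)]) auto
  ultimately have "(\<lambda>x. if x \<in> \<Omega> then D x else 0) \<in> borel_measurable lebesgue"
    by (rule borel_measurable_AE)
  then show ?thesis using assms(1) borel_measurable_if_D by blast
qed

text \<open>The p-th power of \<open>norm (D x)\<close> is dominated almost everywhere by the sum of
  \<open>C k powr p\<close> times the indicator of \<open>N k\<close>, also if the sets overlap;
  integrating term by term leaves a geometric series with sum
  \<open>\<epsilon> powr p\<close>.\<close>

lemma Lp_norm_le_series: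
  fixes D :: "real^'n \<Rightarrow> 'b::euclidean_space"
  assumes "1 \<le> p" "open \<Omega>" "D \<in> borel_measurable (lebesgue_on \<Omega>)" "0 < \<epsilon>"
    and N: "\<And>k. open (N k)" and C: "\<And>k. 0 \<le> C k"
    and meas: "\<And>k. ennreal (C k powr p) * emeasure lebesgue (N k) \<le> ennreal (\<epsilon> powr p * (1 / 2) ^ Suc k)"
    and ae: "AE x in lebesgue_on \<Omega>. D x = 0 \<or> (\<exists>k::nat. x \<in> N k \<and> norm (D x) \<le> C k)"
  shows "Lp_norm p \<Omega> D \<le> ennreal \<epsilon>"
proof -
  define I where "I = (\<integral>\<^sup>+ x. ennreal (norm (D x) powr p) \<partial>lebesgue_on \<Omega>)"
  have "I \<le> (\<integral>\<^sup>+ x. (\<Sum>k. ennreal (C k powr p) * indicator (N k \<inter> \<Omega>) x) \<partial>lebesgue_on \<Omega>)"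
    unfolding I_def
  proof (rule nn_integral_mono_AE)
    have "AE x in lebesgue_on \<Omega>. x \<in> \<Omega>" by (rule AE_I2) simp
    with ae show "AE x in lebesgue_on \<Omega>. ennreal (norm (D x) powr p)
        \<le> (\<Sum>k. ennreal (C k powr p) * indicator (N k \<inter> \<Omega>) x)"
    proof eventually_elim
      case (elim x)
      show ?case
      proof (cases "D x = 0")
        case False
        then obtain k where k: "x \<in> N k" "norm (D x) \<le> C k" using elim by blast
        have "ennreal (norm (D x) powr p) \<le> ennreal (C k powr p)"
          using k(2) assms(1) by (intro ennreal_leI powr_mono2) auto
        also have "\<dots> = (\<Sum>j\<in>{k}. ennreal (C j powr p) * indicator (N j \<inter> \<Omega>) x)"
          using k(1) elim by simp
        also have "\<dots> \<le> (\<Sum>j. ennreal (C j powr p) * indicator (N j \<inter> \<Omega>) x)"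
          by (rule sum_le_suminf) auto
        finally show ?thesis .
      qed simp
    qed
  qed
  also have "\<dots> = (\<Sum>k. \<integral>\<^sup>+ x. ennreal (C k powr p) * indicator (N k \<inter> \<Omega>) x \<partial>lebesgue_on \<Omega>)"
  proof (rule nn_integral_suminf)
    fix k
    have "N k \<inter> \<Omega> \<in> sets (lebesgue_on \<Omega>)" using N assms(2) by (auto simp: sets_restrict_space_iff)
    then show "(\<lambda>x. ennreal (C k powr p) * indicator (N k \<inter> \<Omega>) x) \<in> borel_measurable (lebesgue_on \<Omega>)"
      by (intro borel_measurable_times_ennreal borel_measurable_const borel_measurable_indicator)
  qed
  also have "\<dots> \<le> (\<Sum>k. ennreal (\<epsilon> powr p * (1 / 2) ^ Suc k))"
  proof (rule suminf_le)
    fix k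
    have "N k \<inter> \<Omega> \<in> sets (lebesgue_on \<Omega>)" using N assms(2) by (auto simp: sets_restrict_space_iff)
    then have "(\<integral>\<^sup>+ x. ennreal (C k powr p) * indicator (N k \<inter> \<Omega>) x \<partial>lebesgue_on \<Omega>)
        = ennreal (C k powr p) * emeasure (lebesgue_on \<Omega>) (N k \<inter> \<Omega>)"
      by (rule nn_integral_cmult_indicator)
    also have "emeasure (lebesgue_on \<Omega>) (N k \<inter> \<Omega>) = emeasure lebesgue (N k \<inter> \<Omega>)"
      using assms(2) by (intro emeasure_restrict_space) auto
    also have "\<dots> \<le> emeasure lebesgue (N k)" using N by (intro emeasure_mono) auto
    finally show "(\<integral>\<^sup>+ x. ennreal (C k powr p) * indicator (N k \<inter> \<Omega>) x \<partial>lebesgue_on \<Omega>)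
        \<le> ennreal (\<epsilon> powr p * (1 / 2) ^ Suc k)"
      using meas[of k] by (meson mult_left_mono order_trans zero_le)
  qed auto
  also have "\<dots> = ennreal (\<epsilon> powr p)"
  proof -
    have "(\<lambda>k. \<epsilon> powr p * (1 / 2) ^ Suc k) sums (\<epsilon> powr p * 1)"
      by (intro sums_mult power_half_series)
    then show ?thesis by (subst suminf_ennreal2) (auto simp: sums_iff)
  qed
  finally have I: "I \<le> ennreal (\<epsilon> powr p)" .
  then have fin: "I < \<infinity>" by (simp add: le_less_trans)
  have "enn2real I \<le> \<epsilon> powr p" using I by (intro enn2real_leI) auto
  then have "enn2real I powr (1 / p) \<le> (\<epsilon> powr p) powr (1 / p)"
    using assms(1) by (intro powr_mono2) auto
  also have "\<dots> = \<epsilon>" using assms(1,4) by (simp add: powr_powr)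
  finally show ?thesis using fin assms(3) unfolding Lp_norm_def I_def[symmetric] Let_def
    by (simp add: ennreal_leI)
qed

theorem theorem1p2:
  fixes \<Omega> :: "(real^'n) set" and f :: "real^'n \<Rightarrow> real^'n" and p \<epsilon> :: real
  assumes "2 \<le> CARD('n)"
    and "1 \<le> p"
    and "open \<Omega>" and "connected \<Omega>"
    and "locally_finite_pw_affine_homeomorphism \<Omega> f"
    and "0 < \<epsilon>"
  shows "\<exists>g. C1_on \<Omega> g \<and> inj_on g \<Omega> \<and>
           Linf_norm \<Omega> (\<lambda>x. g x - f x) < ennreal \<epsilon> \<and>
           Lp_norm p \<Omega> (\<lambda>x. jacobian g (at x) - jacobian f (at x)) < ennreal \<epsilon>"
proof -
  obtain F :: "nat \<Rightarrow> (real^'n) set" and a b where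
    F: "\<And>k. compact (F k)" "\<And>k. F k \<subseteq> \<Omega>" "\<And>k. F k \<subseteq> {x. a k \<bullet> x = b k}" and a: "\<And>k. norm (a k) = 1"
    and lf: "\<And>x. x \<in> \<Omega> \<Longrightarrow> \<exists>r>0. finite {k. F k \<inter> ball x r \<noteq> {}}"
    and lip: "\<And>x. x \<in> \<Omega> \<Longrightarrow> \<exists>r>0. \<exists>L. ball x r \<subseteq> \<Omega> \<and> L-lipschitz_on (ball x r) f"
    and lin: "\<And>x. x \<in> \<Omega> \<Longrightarrow> \<exists>r>0. \<exists>M. \<forall>y\<in>ball x r. \<forall>z\<in>ball x r.
       (\<forall>k. x \<in> F k \<longrightarrow> a k \<bullet> (z - y) = 0) \<longrightarrow> f z - f y = M *v (z - y)"
    by (fact pw_affine_structure[OF assms(3,5)])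
  have "inj_on f \<Omega>"
    using assms(5) unfolding locally_finite_pw_affine_homeomorphism_def homeomorphism_def
    by (metis inj_on_inverseI)
  have f_cont: "continuous_on \<Omega> f"
    using assms(5) unfolding locally_finite_pw_affine_homeomorphism_def homeomorphism_def by blast
  define Z where "Z = (\<Union>k. F k)"
  have negF: "negligible (F k)" for k
    by (rule negligible_subset[OF negligible_hyperplane F(3)]) (use a[of k] in auto)
  have negZ: "negligible Z" unfolding Z_def using negF by (intro negligible_countable_Union) auto
  define n where "n = real CARD('n) * real CARD('n)"
  have n: "0 < n" by (simp add: n_def)
  \<comment> \<open>The radius is doubled because \<open>\<phi> x\<close> is within
    \<open>\<rho>\<close> of \<open>y\<close> and \<open>x\<close> within \<open>\<rho>\<close> of
    \<open>\<phi> x\<close>. In \<open>3 * n * L\<close>, one part bounds the Jacobian of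
    \<open>f\<close> and two that of \<open>g\<close>, as \<open>\<phi>\<close> has Lipschitz
    constant 2. Halving \<open>\<epsilon>\<close> leaves room for the strict inequalities, since the
    estimates of both norms are non-strict.\<close>
  have "\<exists>\<rho> L. 0 < \<rho> \<and> \<rho> \<le> (1 / 2) ^ k \<and> 0 \<le> L \<and> L * \<rho> \<le> \<epsilon> / 2 \<and>
      (\<forall>y\<in>F k. ball y (2 * \<rho>) \<subseteq> \<Omega> \<and> L-lipschitz_on (ball y (2 * \<rho>)) f) \<and>
      ennreal ((3 * n * L) powr p) * emeasure lebesgue (\<Union>y\<in>F k. ball y (2 * \<rho>))
        \<le> ennreal ((\<epsilon> / 2) powr p * (1 / 2) ^ Suc k)" for k
  proof -
    obtain d1 L where d1: "0 < d1" "\<And>y. y \<in> F k \<Longrightarrow> ball y d1 \<subseteq> \<Omega>"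
      "\<And>y. y \<in> F k \<Longrightarrow> L-lipschitz_on (ball y d1) f" and L: "0 \<le> L"
      using uniform_lipschitz_thickening[OF F(1,2) lip] by metis
    define c where "c = (3 * n * L) powr p"
    define m where "m = (\<epsilon> / 2) powr p * (1 / 2) ^ Suc k"
    have c: "0 \<le> c" by (simp add: c_def)
    have m: "0 < m" using assms(6) by (simp add: m_def)
    obtain d2 where d2: "0 < d2" "emeasure lebesgue (\<Union>y\<in>F k. ball y d2) \<le> ennreal (m / (c + 1))"
      using negligible_compact_thickening[OF F(1) negF, of "m / (c + 1)" k] c m by auto
    define \<rho> where "\<rho> = Min {d1 / 2, d2 / 2, (1 / 2) ^ k, \<epsilon> / (2 * (L + 1))}"
    have "0 < \<rho>" using d1(1) d2(1) L assms(6) by (simp add: \<rho>_def)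
    moreover have "\<rho> \<le> d1 / 2" "\<rho> \<le> d2 / 2" "\<rho> \<le> (1 / 2) ^ k" "\<rho> \<le> \<epsilon> / (2 * (L + 1))"
      unfolding \<rho>_def by (intro Min_le; simp)+
    ultimately have \<rho>: "0 < \<rho>" "\<rho> \<le> d1 / 2" "\<rho> \<le> d2 / 2" "\<rho> \<le> (1 / 2) ^ k"
      "\<rho> \<le> \<epsilon> / (2 * (L + 1))" by blast+
    have "(L + 1) * \<rho> \<le> \<epsilon> / 2" using \<rho>(5) L by (simp add: le_divide_eq algebra_simps)
    then have "L * \<rho> \<le> \<epsilon> / 2" using \<rho>(1) by (simp add: algebra_simps)
    moreover have "ball y (2 * \<rho>) \<subseteq> \<Omega> \<and> L-lipschitz_on (ball y (2 * \<rho>)) f" if "y \<in> F k" for y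
    proof -
      have "ball y (2 * \<rho>) \<subseteq> ball y d1" using \<rho>(2) by auto
      then show ?thesis using d1(2,3)[OF that] lipschitz_on_subset by blast
    qed
    moreover have "ennreal c * emeasure lebesgue (\<Union>y\<in>F k. ball y (2 * \<rho>)) \<le> ennreal m"
    proof -
      have "emeasure lebesgue (\<Union>y\<in>F k. ball y (2 * \<rho>)) \<le> emeasure lebesgue (\<Union>y\<in>F k. ball y d2)"
      proof (rule emeasure_mono)
        show "(\<Union>y\<in>F k. ball y (2 * \<rho>)) \<subseteq> (\<Union>y\<in>F k. ball y d2)" using \<rho>(3) by fastforce
        have "open (\<Union>y\<in>F k. ball y d2)" by blast
        then show "(\<Union>y\<in>F k. ball y d2) \<in> sets lebesgue" by auto
      qed
      also note d2(2)
      finally have "ennreal c * emeasure lebesgue (\<Union>y\<in>F k. ball y (2 * \<rho>)) \<le> ennreal c * ennreal (m / (c + 1))"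
        by (rule mult_left_mono) simp
      also have "\<dots> = ennreal (c * (m / (c + 1)))" using c m by (intro ennreal_mult[symmetric]) auto
      also have "\<dots> \<le> ennreal m"
      proof (rule ennreal_leI)
        have "c * m \<le> m * (c + 1)" using m by (simp add: algebra_simps)
        then show "c * (m / (c + 1)) \<le> m" using c by (simp add: divide_le_eq)
      qed
      finally show ?thesis .
    qed
    ultimately show ?thesis using \<rho>(1,4) L unfolding c_def m_def by blast
  qed
  then obtain \<rho> L where \<rho>: "\<And>k. 0 < \<rho> k" "\<And>k. \<rho> k \<le> (1 / 2) ^ k"
    and L: "\<And>k. 0 \<le> L k" "\<And>k. L k * \<rho> k \<le> \<epsilon> / 2"
    and B: "\<And>k y. y \<in> F k \<Longrightarrow> ball y (2 * \<rho> k) \<subseteq> \<Omega>"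
      "\<And>k y. y \<in> F k \<Longrightarrow> (L k)-lipschitz_on (ball y (2 * \<rho> k)) f"
    and meas: "\<And>k. ennreal ((3 * n * L k) powr p) * emeasure lebesgue (\<Union>y\<in>F k. ball y (2 * \<rho> k))
        \<le> ennreal ((\<epsilon> / 2) powr p * (1 / 2) ^ Suc k)"
    by metis
  have B': "ball y (\<rho> k) \<subseteq> \<Omega>" if "y \<in> F k" for k y
    by (rule order_trans[OF subset_ball B(1)[OF that]]) (use \<rho>(1)[of k] in simp)
  obtain \<phi> where \<phi>: "inj \<phi>" "\<And>x. x \<in> \<Omega> \<Longrightarrow> \<phi> x \<in> \<Omega>"
    and \<phi>lip: "\<And>x y. norm (\<phi> x - \<phi> y) \<le> 2 * norm (x - y)"
    and \<phi>strict: "\<And>x. x \<in> \<Omega> \<Longrightarrow>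
      \<exists>P. has_strict_derivative \<phi> P x \<and> (\<forall>k u. \<phi> x \<in> F k \<longrightarrow> a k \<bullet> P u = 0)"
    and \<phi>cases: "\<And>x. x \<in> \<Omega> \<Longrightarrow> (\<exists>r>0. \<forall>z\<in>ball x r. \<phi> z = z) \<or>
       (\<exists>k. \<exists>y\<in>F k. \<phi> x \<in> ball y (\<rho> k) \<and> dist (\<phi> x) x < \<rho> k)"
  proof (rule flattening_homeomorphism[of F a b \<Omega> \<rho>])
  qed ((rule F(1,3) a \<rho>) | (rule lf B', assumption) | (rule that; assumption))+
  define g where "g = f \<circ> \<phi>"
  have C1: "C1_on \<Omega> g"
  proof (rule C1_on_has_strict_derivative)
    fix x assume x: "x \<in> \<Omega>"
    obtain P where P: "has_strict_derivative \<phi> P x" "\<And>k u. \<phi> x \<in> F k \<Longrightarrow> a k \<bullet> P u = 0"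
      using \<phi>strict[OF x] by blast
    obtain r1 K where r1: "r1 > 0" "K-lipschitz_on (ball (\<phi> x) r1) f" using lip[OF \<phi>(2)[OF x]] by blast
    obtain r2 M where r2: "r2 > 0" "\<And>y z. y \<in> ball (\<phi> x) r2 \<Longrightarrow> z \<in> ball (\<phi> x) r2 \<Longrightarrow>
       (\<forall>k. \<phi> x \<in> F k \<longrightarrow> a k \<bullet> (z - y) = 0) \<Longrightarrow> f z - f y = M *v (z - y)"
      using lin[OF \<phi>(2)[OF x]] by blast
    have "has_strict_derivative g (\<lambda>u. M *v P u) x"
      unfolding g_def
    proof (rule compose_has_strict_derivative_of_flattening[of _ _ _ F a, OF P \<phi>lip])
      show "0 < min r1 r2" using r1 r2 by simp
      show "K-lipschitz_on (ball (\<phi> x) (min r1 r2)) f" by (rule lipschitz_on_subset[OF r1(2)]) auto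
      show "f z - f y = M *v (z - y)" if "y \<in> ball (\<phi> x) (min r1 r2)" "z \<in> ball (\<phi> x) (min r1 r2)"
        "\<And>k. \<phi> x \<in> F k \<Longrightarrow> a k \<bullet> (z - y) = 0" for y z
        using r2(2)[of y z] that by simp
    qed
    then show "\<exists>D. has_strict_derivative g D x" by blast
  qed
  have C1f: "C1_on (\<Omega> - Z) f"
  proof (rule C1_on_has_strict_derivative)
    fix x assume x: "x \<in> \<Omega> - Z"
    then have nF: "x \<notin> F k" for k by (simp add: Z_def)
    obtain r M where "r > 0" "\<forall>y\<in>ball x r. \<forall>z\<in>ball x r.
        (\<forall>k. x \<in> F k \<longrightarrow> a k \<bullet> (z - y) = 0) \<longrightarrow> f z - f y = M *v (z - y)"
      using lin[of x] x by blast
    then have r: "r > 0" "\<And>y z. y \<in> ball x r \<Longrightarrow> z \<in> ball x r \<Longrightarrow> f z - f y = M *v (z - y)"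
      using nF by simp_all
    have "has_strict_derivative f (\<lambda>u. M *v u) x"
      unfolding has_strict_derivative_def
      using r by (auto simp: matrix_vector_mul_bounded_linear intro!: exI[of _ r])
    then show "\<exists>D. has_strict_derivative f D x" by blast
  qed
  have inj: "inj_on g \<Omega>"
    unfolding g_def by (rule comp_inj_on) (use \<phi> \<open>inj_on f \<Omega>\<close> in \<open>auto intro: inj_on_subset\<close>)
  have g_cont: "continuous_on \<Omega> g"
    using C1 unfolding C1_on_def
    by (intro continuous_at_imp_continuous_on) (auto intro: differentiable_imp_continuous_within)
  have near: "\<exists>k. \<exists>y\<in>F k. \<phi> x \<in> ball y (2 * \<rho> k) \<and> x \<in> ball y (2 * \<rho> k) \<and> dist (\<phi> x) x < \<rho> k"
    if x: "x \<in> \<Omega>" "\<not> (\<exists>r>0. \<forall>z\<in>ball x r. \<phi> z = z)" for x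
  proof -
    obtain k y where ky: "y \<in> F k" "\<phi> x \<in> ball y (\<rho> k)" "dist (\<phi> x) x < \<rho> k"
      using \<phi>cases[OF x(1)] x(2) by blast
    have "dist y x < 2 * \<rho> k" using ky(2,3) dist_triangle[of y x "\<phi> x"] by simp
    then show ?thesis using ky \<rho>(1)[of k] by (intro exI[of _ k] bexI[of _ y]) auto
  qed
  have sup: "norm (g x - f x) \<le> \<epsilon> / 2" if x: "x \<in> \<Omega>" for x
  proof (cases "\<exists>r>0. \<forall>z\<in>ball x r. \<phi> z = z")
    case True
    then have "\<phi> x = x" by auto
    then show ?thesis using assms(6) by (simp add: g_def)
  next
    case False
    obtain k y where ky: "y \<in> F k" "\<phi> x \<in> ball y (2 * \<rho> k)" "x \<in> ball y (2 * \<rho> k)" "dist (\<phi> x) x < \<rho> k"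
      using near[OF x False] by blast
    have "norm (g x - f x) \<le> L k * dist (\<phi> x) x"
      using lipschitz_onD[OF B(2)[OF ky(1)] ky(2,3)] by (simp add: g_def dist_norm)
    also have "\<dots> \<le> L k * \<rho> k" using ky(4) L(1) by (intro mult_left_mono) auto
    also have "\<dots> \<le> \<epsilon> / 2" by (rule L(2))
    finally show ?thesis .
  qed
  have Linf: "Linf_norm \<Omega> (\<lambda>x. g x - f x) \<le> ennreal (\<epsilon> / 2)"
    unfolding Linf_norm_def
  proof (rule esssup_I)
    have "(\<lambda>x. g x - f x) \<in> borel_measurable (lebesgue_on \<Omega>)"
      using assms(3) by (intro continuous_imp_measurable_on_sets_lebesgue continuous_intros g_cont f_cont) auto
    then show "(\<lambda>x. ennreal (norm (g x - f x))) \<in> borel_measurable (lebesgue_on \<Omega>)" by measurable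
    show "AE x in lebesgue_on \<Omega>. ennreal (norm (g x - f x)) \<le> ennreal (\<epsilon> / 2)"
      by (rule AE_I2) (use sup in \<open>simp add: ennreal_leI\<close>)
  qed
  define D where "D = (\<lambda>x. jacobian g (at x) - jacobian f (at x))"
  define N where "N = (\<lambda>k. \<Union>y\<in>F k. ball y (2 * \<rho> k))"
  have D: "D x = 0 \<or> (\<exists>k. x \<in> N k \<and> norm (D x) \<le> 3 * n * L k)" if x: "x \<in> \<Omega>" "x \<notin> Z" for x
  proof -
    have fd: "f differentiable (at x)" and gd: "g differentiable (at x)"
      using C1 C1f x by (auto simp: C1_on_def)
    show ?thesis
    proof (cases "\<exists>r>0. \<forall>z\<in>ball x r. \<phi> z = z")
      case True
      then obtain r where r: "r > 0" "\<forall>z\<in>ball x r. \<phi> z = z" by blast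
      obtain E where E: "(f has_derivative E) (at x)" using fd differentiable_def by blast
      have "(g has_derivative E) (at x)"
        by (rule has_derivative_transform_within_open[OF E, of "ball x r"]) (use r in \<open>auto simp: g_def\<close>)
      then have "jacobian g (at x) *v u = jacobian f (at x) *v u" for u
        using jacobian_mult_vec E by metis
      then have "jacobian g (at x) = jacobian f (at x)" by (simp add: matrix_eq)
      then show ?thesis by (simp add: D_def)
    next
      case False
      obtain k y where ky: "y \<in> F k" "\<phi> x \<in> ball y (2 * \<rho> k)" "x \<in> ball y (2 * \<rho> k)"
        using near[OF x(1) False] by blast
      note Lk = lipschitz_onD[OF B(2)[OF ky(1)]]
      obtain r1 where r1: "r1 > 0" "ball x r1 \<subseteq> ball y (2 * \<rho> k)"
        using ky(3) open_ball open_contains_ball by meson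
      obtain r2 where r2: "r2 > 0" "ball (\<phi> x) r2 \<subseteq> ball y (2 * \<rho> k)"
        using ky(2) open_ball open_contains_ball by meson
      have "norm (jacobian f (at x)) \<le> real CARD('n) * (real CARD('n) * L k)"
      proof (rule norm_jacobian_le[OF fd r1(1)])
        fix z assume "z \<in> ball x r1"
        then show "norm (f z - f x) \<le> L k * norm (z - x)"
          using Lk[of z x] r1(2) ky(3) by (auto simp: dist_norm)
      qed
      moreover have "norm (jacobian g (at x)) \<le> real CARD('n) * (real CARD('n) * (L k * 2))"
      proof (rule norm_jacobian_le[OF gd])
        show "0 < r2 / 2" using r2 by simp
        fix z assume z: "z \<in> ball x (r2 / 2)"
        have "\<phi> z \<in> ball (\<phi> x) r2" using \<phi>lip[of x z] z by (simp add: dist_norm)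
        then have "norm (g z - g x) \<le> L k * norm (\<phi> z - \<phi> x)"
          using Lk[of "\<phi> z" "\<phi> x"] r2(2) ky(2) by (auto simp: dist_norm g_def)
        also have "\<dots> \<le> L k * (2 * norm (z - x))" using \<phi>lip L(1) by (intro mult_left_mono) auto
        finally show "norm (g z - g x) \<le> L k * 2 * norm (z - x)" by simp
      qed
      moreover have "norm (D x) \<le> norm (jacobian g (at x)) + norm (jacobian f (at x))"
        unfolding D_def by (rule norm_triangle_ineq4)
      ultimately have "norm (D x) \<le> 3 * n * L k" by (simp add: n_def)
      moreover have "x \<in> N k" using ky by (auto simp: N_def)
      ultimately show ?thesis by blast
    qed
  qed
  have "Lp_norm p \<Omega> D \<le> ennreal (\<epsilon> / 2)"
  proof (rule Lp_norm_le_series[where N = N and C = "\<lambda>k. 3 * n * L k"])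
    show "D \<in> borel_measurable (lebesgue_on \<Omega>)"
    proof (rule borel_measurable_lebesgue_on_continuous_off_negligible[OF assms(3) negZ])
      show "continuous_on (\<Omega> - Z) D"
        unfolding D_def using C1 C1f unfolding C1_on_def
        by (intro continuous_intros) (auto intro: continuous_on_subset)
    qed
    show "open (N k)" for k by (auto simp: N_def)
    show "0 \<le> 3 * n * L k" for k using n L(1) by simp
    show "ennreal ((3 * n * L k) powr p) * emeasure lebesgue (N k)
        \<le> ennreal ((\<epsilon> / 2) powr p * (1 / 2) ^ Suc k)" for k
      unfolding N_def by (rule meas)
    show "AE x in lebesgue_on \<Omega>. D x = 0 \<or> (\<exists>k. x \<in> N k \<and> norm (D x) \<le> 3 * n * L k)"
      by (rule AE_lebesgue_on_notin[OF assms(3) negZ D])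
  qed (use assms in auto)
  moreover have "ennreal (\<epsilon> / 2) < ennreal \<epsilon>" using assms(6) by (simp add: ennreal_lessI)
  ultimately show ?thesis using C1 inj Linf unfolding D_def by (meson le_less_trans)
qed

end
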